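(* Let $\mathcal{S}$ be a finite elation generalized quadrangle of order $(s,t)$ with elation group $G$ and associated $4$-gonal family $(G,\{A_i\}_{i=0}^t,\{A_i^*\}_{i=0}^t)$. For $g\in G$ define \[\chi_S(g)=\frac{1}{s(s+t)}\sum_{i=0}^t\Big(|C_G(g)|\,(s|A_i\cap g^G|+|A_i^*\cap g^G|)-|G/G'|\,(s|A_i\cap gG'|+|A_i^*\cap gG'|)\Big),\] \[\chi_T(g)=\frac{\gcd(s,t)}{st(s+t)}\sum_{i=0}^t\Big(|C_G(g)|\,(t|A_i\cap g^G|-|A_i^*\cap g^G|)-|G/G'|\,(t|A_i\cap gG'|-|A_i^*\cap gG'|)\Big).\] Then $\chi_S$ and $\chi_T$ are (complex) characters of $G$.
   Context: A generalized quadrangle of order $(s,t)$: each line has $s+1$ points, each point is on $t+1$ lines, and for each non-incident point-line pair $(P,\ell)$ there is a unique point on $\ell$ collinear with $P$. An elation about $P$ is an automorphism that is the identity or fixes each line through $P$ and no point not collinear with $P$. $\mathcal{S}$ is an elation generalized quadrangle with base point $P$ and elation group $G$ if $G$ consists of elations about $P$ and acts regularly on the points not collinear with $P$. The associated $4$-gonal family: fix a point $y$ not collinear with $P$, let $M_0,\dots,M_t$ be the lines through $y$, let $z_i$ be the unique point of $M_i$ collinear with $P$, and let $A_i$, $A_i^*$ be the stabilizers in $G$ of $M_i$ and $z_i$ respectively. $g^G$ is the conjugacy class of $g$, $C_G(g)$ its centralizer, $G'$ the derived subgroup. *)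

theory Defs
  imports "HOL-Algebra.Algebra" "Jordan_Normal_Form.Matrix"
begin

definition collinear :: "'p set \<Rightarrow> 'l set \<Rightarrow> ('p \<Rightarrow> 'l \<Rightarrow> bool) \<Rightarrow> 'p \<Rightarrow> 'p \<Rightarrow> bool" where
  "collinear P L I x y \<longleftrightarrow> x \<in> P \<and> y \<in> P \<and> (\<exists>l\<in>L. I x l \<and> I y l)"

definition fin_GQ :: "'p set \<Rightarrow> 'l set \<Rightarrow> ('p \<Rightarrow> 'l \<Rightarrow> bool) \<Rightarrow> nat \<Rightarrow> nat \<Rightarrow> bool" where
  "fin_GQ P L I s t \<longleftrightarrow>
     finite P \<and> finite L \<and> s \<ge> 1 \<and> t \<ge> 1 \<and>
     (\<forall>l\<in>L. card {x\<in>P. I x l} = s + 1) \<and>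
     (\<forall>x\<in>P. card {l\<in>L. I x l} = t + 1) \<and>
     (\<forall>x\<in>P. \<forall>y\<in>P. \<forall>l\<in>L. \<forall>m\<in>L. x \<noteq> y \<and> I x l \<and> I y l \<and> I x m \<and> I y m \<longrightarrow> l = m) \<and>
     (\<forall>x\<in>P. \<forall>l\<in>L. \<not> I x l \<longrightarrow> (\<exists>!y. y \<in> P \<and> I y l \<and> collinear P L I x y))"

text \<open>An automorphism is a pair of permutations of points and lines preserving
  incidence in both directions; outside P resp. L they act as the identity
  (so that equality of automorphisms is extensional equality).\<close>
definition automorphisms :: "'p set \<Rightarrow> 'l set \<Rightarrow> ('p \<Rightarrow> 'l \<Rightarrow> bool) \<Rightarrow> (('p \<Rightarrow> 'p) \<times> ('l \<Rightarrow> 'l)) set" where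
  "automorphisms P L I = {(f, g).
     bij_betw f P P \<and> bij_betw g L L \<and>
     (\<forall>x. x \<notin> P \<longrightarrow> f x = x) \<and> (\<forall>l. l \<notin> L \<longrightarrow> g l = l) \<and>
     (\<forall>x\<in>P. \<forall>l\<in>L. I (f x) (g l) \<longleftrightarrow> I x l)}"

definition aut_group :: "(('p \<Rightarrow> 'p) \<times> ('l \<Rightarrow> 'l)) set \<Rightarrow> (('p \<Rightarrow> 'p) \<times> ('l \<Rightarrow> 'l)) monoid" where
  "aut_group G = \<lparr>carrier = G, monoid.mult = (\<lambda>a b. (fst a \<circ> fst b, snd a \<circ> snd b)), monoid.one = (id, id)\<rparr>"

definition is_elation :: "'p set \<Rightarrow> 'l set \<Rightarrow> ('p \<Rightarrow> 'l \<Rightarrow> bool) \<Rightarrow> 'p \<Rightarrow> ('p \<Rightarrow> 'p) \<times> ('l \<Rightarrow> 'l) \<Rightarrow> bool" where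
  "is_elation P L I p \<theta> \<longleftrightarrow> \<theta> \<in> automorphisms P L I \<and>
     (\<theta> = (id, id) \<or>
      ((\<forall>l\<in>L. I p l \<longrightarrow> snd \<theta> l = l) \<and>
       (\<forall>x\<in>P. \<not> collinear P L I p x \<longrightarrow> fst \<theta> x \<noteq> x)))"

definition fin_EGQ :: "'p set \<Rightarrow> 'l set \<Rightarrow> ('p \<Rightarrow> 'l \<Rightarrow> bool) \<Rightarrow> nat \<Rightarrow> nat \<Rightarrow> 'p \<Rightarrow>
    (('p \<Rightarrow> 'p) \<times> ('l \<Rightarrow> 'l)) set \<Rightarrow> bool" where
  "fin_EGQ P L I s t p G \<longleftrightarrow> fin_GQ P L I s t \<and> p \<in> P \<and>
     G \<subseteq> automorphisms P L I \<and> group (aut_group G) \<and>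
     (\<forall>\<theta>\<in>G. is_elation P L I p \<theta>) \<and>
     (\<forall>x\<in>P. \<forall>y\<in>P. \<not> collinear P L I p x \<longrightarrow> \<not> collinear P L I p y \<longrightarrow>
        (\<exists>!\<theta>. \<theta> \<in> G \<and> fst \<theta> x = y))"

text \<open>The lines M_0, ..., M_t through y are indexed by the lines themselves.\<close>
definition lines_through :: "'l set \<Rightarrow> ('p \<Rightarrow> 'l \<Rightarrow> bool) \<Rightarrow> 'p \<Rightarrow> 'l set" where
  "lines_through L I y = {M\<in>L. I y M}"

definition proj_pt :: "'p set \<Rightarrow> 'l set \<Rightarrow> ('p \<Rightarrow> 'l \<Rightarrow> bool) \<Rightarrow> 'p \<Rightarrow> 'l \<Rightarrow> 'p" where
  "proj_pt P L I p M = (THE z. z \<in> P \<and> I z M \<and> collinear P L I p z)"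

definition fam_A :: "(('p \<Rightarrow> 'p) \<times> ('l \<Rightarrow> 'l)) set \<Rightarrow> 'l \<Rightarrow> (('p \<Rightarrow> 'p) \<times> ('l \<Rightarrow> 'l)) set" where
  "fam_A G M = {\<theta>\<in>G. snd \<theta> M = M}"

definition fam_Astar :: "'p set \<Rightarrow> 'l set \<Rightarrow> ('p \<Rightarrow> 'l \<Rightarrow> bool) \<Rightarrow> 'p \<Rightarrow>
    (('p \<Rightarrow> 'p) \<times> ('l \<Rightarrow> 'l)) set \<Rightarrow> 'l \<Rightarrow> (('p \<Rightarrow> 'p) \<times> ('l \<Rightarrow> 'l)) set" where
  "fam_Astar P L I p G M = {\<theta>\<in>G. fst \<theta> (proj_pt P L I p M) = proj_pt P L I p M}"

definition conj_class :: "('a, 'b) monoid_scheme \<Rightarrow> 'a \<Rightarrow> 'a set" where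
  "conj_class G g = {h \<otimes>\<^bsub>G\<^esub> g \<otimes>\<^bsub>G\<^esub> inv\<^bsub>G\<^esub> h | h. h \<in> carrier G}"

definition centralizer_el :: "('a, 'b) monoid_scheme \<Rightarrow> 'a \<Rightarrow> 'a set" where
  "centralizer_el G g = {h \<in> carrier G. h \<otimes>\<^bsub>G\<^esub> g = g \<otimes>\<^bsub>G\<^esub> h}"

definition mat_trace :: "complex mat \<Rightarrow> complex" where
  "mat_trace A = (\<Sum>i<dim_row A. A $$ (i, i))"

definition is_rep :: "('a, 'b) monoid_scheme \<Rightarrow> nat \<Rightarrow> ('a \<Rightarrow> complex mat) \<Rightarrow> bool" where
  "is_rep G n \<rho> \<longleftrightarrow>
     (\<forall>g\<in>carrier G. \<rho> g \<in> carrier_mat n n) \<and>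
     \<rho> \<one>\<^bsub>G\<^esub> = 1\<^sub>m n \<and>
     (\<forall>g\<in>carrier G. \<forall>h\<in>carrier G. \<rho> (g \<otimes>\<^bsub>G\<^esub> h) = \<rho> g * \<rho> h)"

text \<open>A (complex) character of G: the trace function of some complex representation
  (degree 0, i.e. the zero character, allowed).\<close>
definition is_character :: "('a, 'b) monoid_scheme \<Rightarrow> ('a \<Rightarrow> complex) \<Rightarrow> bool" where
  "is_character G \<chi> \<longleftrightarrow>
     (\<exists>n \<rho>. is_rep G n \<rho> \<and> (\<forall>g\<in>carrier G. \<chi> g = mat_trace (\<rho> g)))"

end

theory Submission
  imports Defs
begin

text \<open>
  In the group algebra of the elation group, put \<open>X = \<Sum> A\<^sub>i\<close>, \<open>Y = \<Sum> A\<^sub>i\<^sup>*\<close> and let \<open>J\<close> be the sum of all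
  elements. Counting points of the quadrangle gives, modulo multiples of \<open>J\<close>,
  \<open>X\<^sup>2 = (s + t) X - Y\<close>, \<open>X Y = Y X = s Y\<close> and \<open>Y\<^sup>2 = s t Y\<close>. Hence \<open>s X + Y\<close>, \<open>t X - Y\<close> and each
  \<open>t A\<^sub>i - A\<^sub>i\<^sup>*\<close> square to \<open>s (s + t)\<close>, \<open>t (s + t)\<close> and \<open>s t\<close> times themselves. Since \<open>J\<close> is killed by
  \<open>1 - e\<close>, where \<open>e\<close> is the central idempotent of the derived subgroup, they become multiples of
  idempotents after multiplication by \<open>1 - e\<close>. The left ideal generated by an idempotent \<open>E\<close> has
  character \<open>g \<mapsto> \<Sum>\<^sub>x E (x\<^sup>-\<^sup>1 g x)\<close>. For \<open>s X + Y\<close> this character is \<open>\<chi>\<^sub>S\<close>; for \<open>t X - Y\<close> it is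
  \<open>s / gcd s t\<close> times \<open>\<chi>\<^sub>T\<close>, and summed over the \<open>t A\<^sub>i - A\<^sub>i\<^sup>*\<close> it is \<open>(s + t) / gcd s t\<close> times \<open>\<chi>\<^sub>T\<close>.
  These two multiples are coprime, so \<open>\<chi>\<^sub>T\<close> is a difference of characters of which a multiple is a
  character, and therefore a character.
\<close>

section \<open>Complex kernels on finite sets\<close>

text \<open>Matrices are plain functions here, indexed by arbitrary sets. Products, disjoint unions
  and the group itself can then index a basis without being enumerated; matrices with natural
  indices appear only in passing to and from \<open>is_rep\<close>.\<close>

definition kmult :: "'z set \<Rightarrow> ('x \<Rightarrow> 'z \<Rightarrow> complex) \<Rightarrow> ('z \<Rightarrow> 'y \<Rightarrow> complex) \<Rightarrow> 'x \<Rightarrow> 'y \<Rightarrow> complex" where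
  "kmult Z A B = (\<lambda>x y. \<Sum>z\<in>Z. A x z * B z y)"

definition kid :: "'x set \<Rightarrow> 'x \<Rightarrow> 'x \<Rightarrow> complex" where
  "kid V = (\<lambda>x y. if x \<in> V \<and> x = y then 1 else 0)"

definition ktr :: "'x set \<Rightarrow> ('x \<Rightarrow> 'x \<Rightarrow> complex) \<Rightarrow> complex" where
  "ktr V A = (\<Sum>x\<in>V. A x x)"

text \<open>Extension by zero outside \<open>V\<close> and \<open>W\<close> makes identities between
  kernels genuine equations of functions, so they can be used for rewriting.\<close>

definition kernel_on :: "'x set \<Rightarrow> 'y set \<Rightarrow> ('x \<Rightarrow> 'y \<Rightarrow> complex) \<Rightarrow> bool" where
  "kernel_on V W A \<longleftrightarrow> (\<forall>x y. x \<notin> V \<or> y \<notin> W \<longrightarrow> A x y = 0)"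

section \<open>Algebra of kernels and their traces\<close>

lemma kmult_assoc: "kmult W (kmult V A B) C = kmult V A (kmult W B C)"
  unfolding kmult_def
  by (intro ext) (simp add: sum_distrib_left sum_distrib_right mult.assoc, rule sum.swap)

lemma kmult_diff_left: "kmult V (\<lambda>x y. A x y - B x y) C = (\<lambda>x y. kmult V A C x y - kmult V B C x y)"
  by (simp add: kmult_def left_diff_distrib sum_subtractf)

lemma kmult_diff_right: "kmult V C (\<lambda>x y. A x y - B x y) = (\<lambda>x y. kmult V C A x y - kmult V C B x y)"
  by (simp add: kmult_def right_diff_distrib sum_subtractf)

lemma kmult_sum_left: "kmult V (\<lambda>x y. \<Sum>g\<in>G. A g x y) C = (\<lambda>x y. \<Sum>g\<in>G. kmult V (A g) C x y)"
  unfolding kmult_def by (intro ext) (simp add: sum_distrib_right, rule sum.swap)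

lemma kmult_sum_right: "kmult V C (\<lambda>x y. \<Sum>g\<in>G. A g x y) = (\<lambda>x y. \<Sum>g\<in>G. kmult V C (A g) x y)"
  unfolding kmult_def by (intro ext) (simp add: sum_distrib_left, rule sum.swap)

lemma kmult_scale_left: "kmult V (\<lambda>x y. A x y / c) C = (\<lambda>x y. kmult V A C x y / c)"
  by (simp add: kmult_def sum_divide_distrib)

lemma kmult_scale_right: "kmult V C (\<lambda>x y. A x y / c) = (\<lambda>x y. kmult V C A x y / c)"
  by (simp add: kmult_def sum_divide_distrib)

lemma ktr_kmult_commute: "ktr V (kmult W A B) = ktr W (kmult V B A)"
  unfolding ktr_def kmult_def by (subst sum.swap) (simp add: mult.commute)

lemma ktr_diff: "ktr V (\<lambda>x y. A x y - B x y) = ktr V A - ktr V B"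
  by (simp add: ktr_def sum_subtractf)

lemma ktr_kid: "ktr {..<k} (kid {..<k}) = of_nat k"
  by (simp add: ktr_def kid_def)

lemma kmult_kid_left: "finite V \<Longrightarrow> kernel_on V W A \<Longrightarrow> kmult V (kid V) A = A"
proof (intro ext)
  fix x y assume V: "finite V" and A: "kernel_on V W A"
  have "kmult V (kid V) A x y = (\<Sum>z\<in>V. if z = x then A x y else 0)"
    unfolding kmult_def kid_def by (intro sum.cong) auto
  also have "\<dots> = A x y" using A V by (auto simp: kernel_on_def)
  finally show "kmult V (kid V) A x y = A x y" .
qed

lemma kmult_kid_right: "finite W \<Longrightarrow> kernel_on V W A \<Longrightarrow> kmult W A (kid W) = A"
proof (intro ext)
  fix x y assume W: "finite W" and A: "kernel_on V W A"
  have "kmult W A (kid W) x y = (\<Sum>z\<in>W. if z = y then A x y else 0)"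
    unfolding kmult_def kid_def by (intro sum.cong) auto
  also have "\<dots> = A x y" using A W by (auto simp: kernel_on_def)
  finally show "kmult W A (kid W) x y = A x y" .
qed

lemma kernel_on_kmult: "kernel_on V Z A \<Longrightarrow> kernel_on Z W B \<Longrightarrow> kernel_on V W (kmult Z A B)"
  by (auto simp: kernel_on_def kmult_def intro!: sum.neutral)

lemma kernel_on_kid: "kernel_on V V (kid V)"
  by (auto simp: kernel_on_def kid_def)

lemma kmult_kid_kid: "finite V \<Longrightarrow> kmult V (kid V) (kid V) = kid V"
  by (rule kmult_kid_left[OF _ kernel_on_kid])

text \<open>Wedderburn's rank reduction: subtracting \<open>M x b * M a y / M a b\<close> clears the pivot row and column.\<close>

lemma rank_factorization_pointwise:
  fixes M :: "'x \<Rightarrow> 'y \<Rightarrow> complex"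
  assumes V: "finite V" and W: "finite W"
  shows "\<exists>k B C L R. (\<forall>x\<in>V. \<forall>y\<in>W. M x y = (\<Sum>c<k. B x c * C c y)) \<and>
     (\<forall>c<k. \<forall>d<k. (\<Sum>x\<in>V. L c x * B x d) = (if c = d then 1 else 0)) \<and>
     (\<forall>c<k. \<forall>d<(k::nat). (\<Sum>y\<in>W. C c y * R y d) = (if c = d then 1 else (0::complex)))"
proof (induction "card {x\<in>V. \<exists>y\<in>W. M x y \<noteq> 0}" arbitrary: M rule: less_induct)
  case less
  show ?case
  proof (cases "\<forall>x\<in>V. \<forall>y\<in>W. M x y = 0")
    case True
    then show ?thesis by (intro exI[of _ 0]) auto
  next
    case False
    then obtain a b where ab: "a \<in> V" "b \<in> W" "M a b \<noteq> 0" by blast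
    define m where "m = M a b"
    have m: "m \<noteq> 0" using ab m_def by simp
    define M' where "M' = (\<lambda>x y. M x y - M x b * M a y / m)"
    have M'a: "M' a y = 0" for y using m by (simp add: M'_def m_def)
    have M'b: "M' x b = 0" for x using m by (simp add: M'_def m_def)
    \<comment> \<open>A zero row of \<open>M\<close> stays zero in \<open>M'\<close>, and the pivot
      row \<open>a\<close> becomes zero, so the number of nonzero rows drops.\<close>
    have sub: "{x\<in>V. \<exists>y\<in>W. M' x y \<noteq> 0} \<subseteq> {x\<in>V. \<exists>y\<in>W. M x y \<noteq> 0} - {a}"
    proof
      fix x assume "x \<in> {x\<in>V. \<exists>y\<in>W. M' x y \<noteq> 0}"
      then obtain y where xy: "x \<in> V" "y \<in> W" "M' x y \<noteq> 0" by blast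
      then have "x \<noteq> a" using M'a by auto
      moreover have "M x y \<noteq> 0 \<or> M x b \<noteq> 0" using xy by (auto simp: M'_def)
      ultimately show "x \<in> {x\<in>V. \<exists>y\<in>W. M x y \<noteq> 0} - {a}" using xy ab by blast
    qed
    have "card {x\<in>V. \<exists>y\<in>W. M' x y \<noteq> 0} < card {x\<in>V. \<exists>y\<in>W. M x y \<noteq> 0}"
    proof (rule psubset_card_mono)
      have "a \<in> {x\<in>V. \<exists>y\<in>W. M x y \<noteq> 0}" using ab by blast
      then show "{x\<in>V. \<exists>y\<in>W. M' x y \<noteq> 0} \<subset> {x\<in>V. \<exists>y\<in>W. M x y \<noteq> 0}" using sub by blast
    qed (simp add: V)
    from less[OF this] obtain k B C L R where
      BC: "\<And>x y. x \<in> V \<Longrightarrow> y \<in> W \<Longrightarrow> M' x y = (\<Sum>c<k. B x c * C c y)" and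
      LB: "\<And>c d. c < k \<Longrightarrow> d < k \<Longrightarrow> (\<Sum>x\<in>V. L c x * B x d) = (if c = d then 1 else 0)" and
      CR: "\<And>c d. c < k \<Longrightarrow> d < (k::nat) \<Longrightarrow> (\<Sum>y\<in>W. C c y * R y d) = (if c = d then 1 else (0::complex))"
      by blast
    \<comment> \<open>Row \<open>a\<close> of \<open>M'\<close> is zero and \<open>C\<close> has a
      right inverse, so row \<open>a\<close> of \<open>B\<close> is zero. Dually, column
      \<open>b\<close> of \<open>C\<close> is zero because \<open>B\<close> has a left
      inverse.\<close>
    have Ba: "B a d = 0" if "d < k" for d
    proof -
      have "B a d = (\<Sum>c<k. B a c * (if c = d then 1 else 0))"
        using that by (simp add: if_distrib[of "(*) _"] cong: if_cong)
      also have "\<dots> = (\<Sum>c<k. B a c * (\<Sum>y\<in>W. C c y * R y d))" using that CR by simp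
      also have "\<dots> = (\<Sum>y\<in>W. (\<Sum>c<k. B a c * C c y) * R y d)"
        by (simp add: sum_distrib_left sum_distrib_right mult.assoc) (rule sum.swap)
      also have "\<dots> = (\<Sum>y\<in>W. M' a y * R y d)" by (intro sum.cong) (simp_all add: BC[OF ab(1)])
      also have "\<dots> = 0" by (simp add: M'a)
      finally show ?thesis .
    qed
    have Cb: "C c b = 0" if "c < k" for c
    proof -
      have "C c b = (\<Sum>d<k. (if c = d then 1 else 0) * C d b)"
        using that by (simp add: if_distrib[of "\<lambda>u. u * _"] cong: if_cong)
      also have "\<dots> = (\<Sum>d<k. (\<Sum>x\<in>V. L c x * B x d) * C d b)" using that LB by simp
      also have "\<dots> = (\<Sum>x\<in>V. L c x * (\<Sum>d<k. B x d * C d b))"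
        by (simp add: sum_distrib_left sum_distrib_right mult.assoc) (rule sum.swap)
      also have "\<dots> = (\<Sum>x\<in>V. L c x * M' x b)"
        by (intro sum.cong refl) (simp add: BC[OF _ ab(2)])
      also have "\<dots> = 0" by (simp add: M'b)
      finally show ?thesis .
    qed
    \<comment> \<open>The factors gain the pivot column and the scaled pivot row. The new row of
      \<open>L2\<close> is evaluation at \<open>a\<close> divided by \<open>m\<close>: it gives 1 on
      the new column and 0 on the old ones by \<open>Ba\<close>. Old rows of \<open>L\<close> are
      corrected by a multiple of it so that they kill the new column. \<open>R2\<close> is built
      dually from evaluation at \<open>b\<close>.\<close>
    define B2 where "B2 = (\<lambda>x c. if c < k then B x c else M x b)"
    define C2 where "C2 = (\<lambda>c y. if c < k then C c y else M a y / m)"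
    define L2 where "L2 = (\<lambda>c x. if c < k then L c x - (if x = a then (\<Sum>u\<in>V. L c u * M u b) / m else 0)
                          else (if x = a then 1 / m else 0))"
    define R2 where "R2 = (\<lambda>y d. if d < k then R y d - (if y = b then (\<Sum>v\<in>W. M a v * R v d) / m else 0)
                          else (if y = b then 1 else 0))"
    have L2s: "(\<Sum>x\<in>V. L2 c x * f x) = (if c < k then (\<Sum>x\<in>V. L c x * f x) - (\<Sum>u\<in>V. L c u * M u b) / m * f a else f a / m)"
      for c f
      using V ab(1) by (simp add: L2_def left_diff_distrib sum_subtractf if_distrib[of "\<lambda>u. u * _"] cong: if_cong)
    have R2s: "(\<Sum>y\<in>W. f y * R2 y d) = (if d < k then (\<Sum>y\<in>W. f y * R y d) - f b * ((\<Sum>v\<in>W. M a v * R v d) / m) else f b)"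
      for d f
      using W ab(2) by (simp add: R2_def right_diff_distrib sum_subtractf if_distrib[of "\<lambda>u. _ * u"] cong: if_cong)
    have 1: "M x y = (\<Sum>c<Suc k. B2 x c * C2 c y)" if "x \<in> V" "y \<in> W" for x y
      using BC[OF that] by (simp add: B2_def C2_def M'_def diff_eq_eq)
    have 2: "(\<Sum>x\<in>V. L2 c x * B2 x d) = (if c = d then 1 else 0)" if "c < Suc k" "d < Suc k" for c d
      using that m LB Ba unfolding L2s by (auto simp: B2_def m_def)
    have 3: "(\<Sum>y\<in>W. C2 c y * R2 y d) = (if c = d then 1 else 0)" if "c < Suc k" "d < Suc k" for c d
      using that m CR Cb unfolding R2s by (auto simp: C2_def m_def sum_divide_distrib[symmetric])
    show ?thesis
      by (intro exI[of _ "Suc k"] exI[of _ B2] exI[of _ C2] exI[of _ L2] exI[of _ R2]) (use 1 2 3 in blast)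
  qed
qed

section \<open>Rank factorizations, generalized inverses and idempotents\<close>

text \<open>The pointwise factors are cut off to zero outside their index sets. The one-sided
  inverses \<open>L\<close> and \<open>R\<close> record that \<open>B\<close> and \<open>C\<close>
  have full rank \<open>k\<close>, and they allow cancellation in later products.\<close>

lemma rank_factorization:
  assumes V: "finite V" and W: "finite W" and M: "kernel_on V W M"
  obtains k :: nat and B C L R where
    "M = kmult {..<k} B C" "kmult V L B = kid {..<k}" "kmult W C R = kid {..<k}"
    "kernel_on V {..<k} B" "kernel_on {..<k} W C" "kernel_on {..<k} V L" "kernel_on W {..<k} R"
proof -
  obtain k :: nat and B C L R where
      BC: "\<And>x y. x \<in> V \<Longrightarrow> y \<in> W \<Longrightarrow> M x y = (\<Sum>c<k. B x c * C c y)" and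
      LB: "\<And>c d. c < k \<Longrightarrow> d < k \<Longrightarrow> (\<Sum>x\<in>V. L c x * B x d) = (if c = d then 1 else 0)" and
      CR: "\<And>c d. c < k \<Longrightarrow> d < k \<Longrightarrow> (\<Sum>y\<in>W. C c y * R y d) = (if c = d then 1 else 0)"
    using rank_factorization_pointwise[OF V W, of M] by blast
  show thesis
  proof (rule that[of k "\<lambda>x c. if x \<in> V \<and> c < k then B x c else 0" "\<lambda>c y. if c < k \<and> y \<in> W then C c y else 0"
         "\<lambda>c x. if c < k \<and> x \<in> V then L c x else 0" "\<lambda>y c. if y \<in> W \<and> c < k then R y c else 0"])
    show "M = kmult {..<k} (\<lambda>x c. if x \<in> V \<and> c < k then B x c else 0) (\<lambda>c y. if c < k \<and> y \<in> W then C c y else 0)"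
    proof (intro ext)
      fix x y
      show "M x y = kmult {..<k} (\<lambda>x c. if x \<in> V \<and> c < k then B x c else 0) (\<lambda>c y. if c < k \<and> y \<in> W then C c y else 0) x y"
        using M BC[of x y] by (cases "x \<in> V \<and> y \<in> W") (auto simp: kmult_def kernel_on_def)
    qed
    show "kmult V (\<lambda>c x. if c < k \<and> x \<in> V then L c x else 0) (\<lambda>x c. if x \<in> V \<and> c < k then B x c else 0) = kid {..<k}"
    proof (intro ext)
      fix c d
      show "kmult V (\<lambda>c x. if c < k \<and> x \<in> V then L c x else 0) (\<lambda>x c. if x \<in> V \<and> c < k then B x c else 0) c d = kid {..<k} c d"
        using LB[of c d] by (cases "c < k \<and> d < k") (auto simp: kmult_def kid_def cong: sum.cong)
    qed
    show "kmult W (\<lambda>c y. if c < k \<and> y \<in> W then C c y else 0) (\<lambda>y c. if y \<in> W \<and> c < k then R y c else 0) = kid {..<k}"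
    proof (intro ext)
      fix c d
      show "kmult W (\<lambda>c y. if c < k \<and> y \<in> W then C c y else 0) (\<lambda>y c. if y \<in> W \<and> c < k then R y c else 0) c d = kid {..<k} c d"
        using CR[of c d] by (cases "c < k \<and> d < k") (auto simp: kmult_def kid_def cong: sum.cong)
    qed
  qed (auto simp: kernel_on_def)
qed

text \<open>With \<open>M = B C\<close>, the product \<open>R L\<close> serves as \<open>N\<close>:
  in \<open>B C R L B C\<close> the inner factors \<open>C R\<close> and \<open>L B\<close> are
  identities.\<close>

lemma generalized_inverse:
  assumes V: "finite V" and W: "finite W" and M: "kernel_on V W M"
  obtains N where "kernel_on W V N" "kmult V (kmult W M N) M = M"
proof -
  obtain k :: nat and B C L R where *:
    "M = kmult {..<k} B C" "kmult V L B = kid {..<k}" "kmult W C R = kid {..<k}"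
    "kernel_on V {..<k} B" "kernel_on {..<k} W C" "kernel_on {..<k} V L" "kernel_on W {..<k} R"
    using rank_factorization[OF assms] by metis
  have "kmult V (kmult W M (kmult {..<k} R L)) M =
     kmult {..<k} B (kmult {..<k} (kmult W C R) (kmult {..<k} (kmult V L B) C))"
    unfolding *(1) by (simp only: kmult_assoc)
  also have "\<dots> = M" using *(5) by (simp add: *(2,3) kmult_kid_left) (simp add: *(1))
  finally show thesis using that kernel_on_kmult *(6,7) by blast
qed

text \<open>From \<open>B C B C = B C\<close>, cancelling \<open>B\<close> on the left by
  \<open>L\<close> and \<open>C\<close> on the right by \<open>R\<close> leaves
  \<open>C B = 1\<close>.\<close>

lemma idempotent_factorization:
  assumes V: "finite V" and E: "kernel_on V V E" and EE: "kmult V E E = E"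
  obtains k :: nat and B C where
    "E = kmult {..<k} B C" "kmult V C B = kid {..<k}" "kernel_on V {..<k} B" "kernel_on {..<k} V C"
proof -
  obtain k :: nat and B C L R where *:
    "E = kmult {..<k} B C" "kmult V L B = kid {..<k}" "kmult V C R = kid {..<k}"
    "kernel_on V {..<k} B" "kernel_on {..<k} V C" "kernel_on {..<k} V L" "kernel_on V {..<k} R"
    using rank_factorization[OF V V E] by metis
  have CB: "kernel_on {..<k} {..<k} (kmult V C B)" using * kernel_on_kmult by blast
  have "kmult V C B = kmult {..<k} (kmult V L B) (kmult {..<k} (kmult V C B) (kmult V C R))"
    unfolding *(2,3) using kmult_kid_left[OF _ CB] kmult_kid_right[OF _ CB] by simp
  also have "\<dots> = kmult V L (kmult V (kmult V (kmult {..<k} B C) (kmult {..<k} B C)) R)"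
    by (simp only: kmult_assoc)
  also have "\<dots> = kmult V L (kmult V (kmult {..<k} B C) R)" using EE by (simp only: *(1)[symmetric])
  also have "\<dots> = kmult {..<k} (kmult V L B) (kmult V C R)" by (simp only: kmult_assoc)
  also have "\<dots> = kid {..<k}" by (simp add: *(2,3) kmult_kid_kid)
  finally show thesis using that * by blast
qed

text \<open>Cyclicity of the trace turns the trace of \<open>B C\<close> into that of
  \<open>C B = 1\<close>, so the trace is the rank and vanishes only for the zero kernel.\<close>

lemma ktr_idempotent:
  assumes "finite V" "kernel_on V V E" "kmult V E E = E"
  obtains k :: nat where "ktr V E = of_nat k" "k = 0 \<longrightarrow> E = (\<lambda>x y. 0)"
proof -
  obtain k :: nat and B C where *:
    "E = kmult {..<k} B C" "kmult V C B = kid {..<k}"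
    using idempotent_factorization[OF assms] by metis
  have "ktr V E = of_nat k" unfolding *(1) by (simp add: ktr_kmult_commute[of V] *(2) ktr_kid)
  moreover have "k = 0 \<longrightarrow> E = (\<lambda>x y. 0)" by (simp add: *(1) kmult_def)
  ultimately show thesis using that by blast
qed

section \<open>Representations and characters\<close>

text \<open>Multiplicative but possibly non-unital: \<open>\<rho> \<one>\<close> is only required to be idempotent, so that the
  restriction to a subrepresentation is multiplication by a commuting idempotent, without a change of basis.\<close>

definition krep :: "('a, 'b) monoid_scheme \<Rightarrow> 'x set \<Rightarrow> ('a \<Rightarrow> 'x \<Rightarrow> 'x \<Rightarrow> complex) \<Rightarrow> bool" where
  "krep H V \<rho> \<longleftrightarrow> finite V \<and> (\<forall>g\<in>carrier H. kernel_on V V (\<rho> g)) \<and>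
     (\<forall>g\<in>carrier H. \<forall>h\<in>carrier H. \<rho> (g \<otimes>\<^bsub>H\<^esub> h) = kmult V (\<rho> g) (\<rho> h))"

lemma is_character_cong:
  "is_character H \<phi> \<Longrightarrow> (\<And>g. g \<in> carrier H \<Longrightarrow> \<phi> g = \<psi> g) \<Longrightarrow> is_character H \<psi>"
  unfolding is_character_def by metis

context group
begin

section \<open>Passing between kernel representations and characters\<close>

text \<open>Factoring the idempotent \<open>\<rho> \<one>\<close> as \<open>B C\<close> with
  \<open>C B = 1\<close> identifies its image with a space of dimension \<open>k\<close>. The
  compression \<open>C \<rho>(g) B\<close> is a unital representation there, and its trace is
  unchanged because \<open>\<rho> \<one>\<close> is absorbed by \<open>\<rho> g\<close>.\<close>

lemma krep_is_character:
  assumes "krep G V \<rho>"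
  shows "is_character G (\<lambda>g. ktr V (\<rho> g))"
proof -
  have V: "finite V" and K: "\<And>g. g \<in> carrier G \<Longrightarrow> kernel_on V V (\<rho> g)"
    and mul: "\<And>g h. g \<in> carrier G \<Longrightarrow> h \<in> carrier G \<Longrightarrow> kmult V (\<rho> g) (\<rho> h) = \<rho> (g \<otimes> h)"
    using assms by (auto simp: krep_def)
  obtain k :: nat and B C where *:
    "\<rho> \<one> = kmult {..<k} B C" "kmult V C B = kid {..<k}" "kernel_on V {..<k} B" "kernel_on {..<k} V C"
    using idempotent_factorization[OF V K[OF one_closed]] mul[OF one_closed one_closed] by auto
  define \<sigma> where "\<sigma> g = kmult V C (kmult V (\<rho> g) B)" for g
  have one: "\<sigma> \<one> = kid {..<k}"
  proof -
    have "\<sigma> \<one> = kmult {..<k} (kmult V C B) (kmult V C B)" unfolding \<sigma>_def *(1) by (simp only: kmult_assoc)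
    then show ?thesis by (simp add: *(2) kmult_kid_kid)
  qed
  have smul: "\<sigma> (g \<otimes> h) = kmult {..<k} (\<sigma> g) (\<sigma> h)" if gh: "g \<in> carrier G" "h \<in> carrier G" for g h
  proof -
    have "kmult {..<k} (\<sigma> g) (\<sigma> h) = kmult V C (kmult V (kmult V (\<rho> g) (kmult V (kmult {..<k} B C) (\<rho> h))) B)"
      unfolding \<sigma>_def by (simp only: kmult_assoc)
    also have "\<dots> = \<sigma> (g \<otimes> h)" using gh by (simp add: *(1)[symmetric] mul \<sigma>_def)
    finally show ?thesis by simp
  qed
  have tr: "ktr {..<k} (\<sigma> g) = ktr V (\<rho> g)" if "g \<in> carrier G" for g
  proof -
    have "ktr {..<k} (\<sigma> g) = ktr V (kmult V (\<rho> g) (kmult {..<k} B C))"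
      unfolding \<sigma>_def by (subst ktr_kmult_commute) (simp only: kmult_assoc)
    then show ?thesis using that by (simp add: *(1)[symmetric] mul)
  qed
  define S where "S g = mat k k (\<lambda>(i, j). \<sigma> g i j)" for g
  have "is_rep G k S"
    unfolding is_rep_def
  proof (intro conjI ballI)
    show "S \<one> = 1\<^sub>m k" by (rule eq_matI) (auto simp: S_def one kid_def)
    fix g h assume gh: "g \<in> carrier G" "h \<in> carrier G"
    show "S (g \<otimes> h) = S g * S h"
      by (rule eq_matI) (auto simp: S_def smul[OF gh] kmult_def scalar_prod_def atLeast0LessThan)
  qed (simp add: S_def)
  moreover have "ktr V (\<rho> g) = mat_trace (S g)" if "g \<in> carrier G" for g
    using tr[OF that] by (simp add: mat_trace_def S_def ktr_def)
  ultimately show ?thesis unfolding is_character_def by blast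
qed

lemma is_characterE:
  assumes "is_character G \<phi>"
  obtains n :: nat and \<rho> where "krep G {..<n} \<rho>" "\<rho> \<one> = kid {..<n}"
    "\<And>g. g \<in> carrier G \<Longrightarrow> \<phi> g = ktr {..<n} (\<rho> g)"
proof -
  obtain n S where S: "is_rep G n S" "\<And>g. g \<in> carrier G \<Longrightarrow> \<phi> g = mat_trace (S g)"
    using assms unfolding is_character_def by blast
  have c: "S g \<in> carrier_mat n n" if "g \<in> carrier G" for g using S that by (auto simp: is_rep_def)
  define \<rho> where "\<rho> g = (\<lambda>i j. if i < n \<and> j < n then S g $$ (i, j) else 0)" for g
  have "krep G {..<n} \<rho>" unfolding krep_def
  proof (intro conjI ballI)
    fix g h assume gh: "g \<in> carrier G" "h \<in> carrier G"
    have "S (g \<otimes> h) = S g * S h" using S gh by (auto simp: is_rep_def)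
    then show "\<rho> (g \<otimes> h) = kmult {..<n} (\<rho> g) (\<rho> h)"
      using c[OF gh(1)] c[OF gh(2)]
      by (intro ext) (auto simp: \<rho>_def kmult_def scalar_prod_def atLeast0LessThan intro!: sum.cong)
  qed (auto simp: \<rho>_def kernel_on_def)
  moreover have "\<rho> \<one> = kid {..<n}"
    using S by (intro ext) (auto simp: is_rep_def \<rho>_def kid_def)
  moreover have "\<phi> g = ktr {..<n} (\<rho> g)" if "g \<in> carrier G" for g
    using S(2)[OF that] c[OF that] by (simp add: mat_trace_def ktr_def \<rho>_def)
  ultimately show thesis using that by blast
qed

lemma is_character_zero: "is_character G (\<lambda>g. 0)"
  using krep_is_character[of "{}::nat set" "\<lambda>g x y. 0"]
  by (simp add: krep_def kernel_on_def kmult_def ktr_def)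

text \<open>The direct sum, with block-diagonal kernels over the disjoint union of the two index
  sets.\<close>

lemma is_character_add:
  assumes "is_character G \<phi>" "is_character G \<psi>"
  shows "is_character G (\<lambda>g. \<phi> g + \<psi> g)"
proof -
  obtain n :: nat and \<rho> where r: "krep G {..<n} \<rho>" "\<And>g. g \<in> carrier G \<Longrightarrow> \<phi> g = ktr {..<n} (\<rho> g)"
    using is_characterE[OF assms(1)] by metis
  obtain m :: nat and \<sigma> where s: "krep G {..<m} \<sigma>" "\<And>g. g \<in> carrier G \<Longrightarrow> \<psi> g = ktr {..<m} (\<sigma> g)"
    using is_characterE[OF assms(2)] by metis
  define \<tau> where "\<tau> g = (\<lambda>x y. case (x, y) of (Inl a, Inl b) \<Rightarrow> \<rho> g a b | (Inr a, Inr b) \<Rightarrow> \<sigma> g a b | _ \<Rightarrow> 0)" for g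
  have "krep G (Sum_Type.Plus {..<n} {..<m}) \<tau>"
    unfolding krep_def
  proof (intro conjI ballI)
    fix g h assume gh: "g \<in> carrier G" "h \<in> carrier G"
    show "\<tau> (g \<otimes> h) = kmult (Sum_Type.Plus {..<n} {..<m}) (\<tau> g) (\<tau> h)"
      using r(1) s(1) gh
      by (intro ext) (auto simp: krep_def \<tau>_def kmult_def sum.Plus split: sum.split)
  next
    fix g assume "g \<in> carrier G"
    then show "kernel_on (Sum_Type.Plus {..<n} {..<m}) (Sum_Type.Plus {..<n} {..<m}) (\<tau> g)"
      using r(1) s(1) by (fastforce simp: krep_def kernel_on_def \<tau>_def split: sum.split)
  qed simp
  from krep_is_character[OF this] show ?thesis
    by (rule is_character_cong) (simp add: r(2) s(2) ktr_def sum.Plus \<tau>_def)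
qed

lemma is_character_sum:
  assumes "finite J" "\<And>j. j \<in> J \<Longrightarrow> is_character G (\<phi> j)"
  shows "is_character G (\<lambda>g. \<Sum>j\<in>J. \<phi> j g)"
  using assms by (induction J rule: finite_induct) (auto intro: is_character_zero is_character_add)


section \<open>Averages over the group and the pairing of characters\<close>

lemma sum_translate_left: "h \<in> carrier G \<Longrightarrow> (\<Sum>g\<in>carrier G. f (h \<otimes> g)) = (\<Sum>g\<in>carrier G. f g)"
  by (rule sum.reindex_bij_witness[of _ "\<lambda>g. inv h \<otimes> g" "\<lambda>g. h \<otimes> g"]) (auto simp: m_assoc[symmetric])

lemma sum_translate_right: "h \<in> carrier G \<Longrightarrow> (\<Sum>g\<in>carrier G. f (g \<otimes> h)) = (\<Sum>g\<in>carrier G. f g)"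
  by (rule sum.reindex_bij_witness[of _ "\<lambda>g. g \<otimes> inv h" "\<lambda>g. g \<otimes> h"]) (auto simp: m_assoc)

text \<open>The average \<open>T\<close> of all \<open>\<tau> g\<close> is idempotent, since
  translation invariance makes each inner sum of its square independent of the outer variable;
  \<open>k\<close> is its rank. The second clause serves to prove \<open>k > 0\<close> from one
  nonzero entry.\<close>

lemma krep_average:
  assumes fin: "finite (carrier G)" and \<tau>: "krep G V \<tau>"
  obtains k :: nat where "(\<Sum>g\<in>carrier G. ktr V (\<tau> g)) = of_nat (order G) * of_nat k"
    "\<And>x y. k = 0 \<Longrightarrow> (\<Sum>g\<in>carrier G. \<tau> g x y) = 0"
proof -
  define N :: complex where "N = of_nat (order G)"
  have N: "N \<noteq> 0" using fin order_gt_0_iff_finite by (simp add: N_def)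
  define T where "T = (\<lambda>x y. (\<Sum>g\<in>carrier G. \<tau> g x y) / N)"
  have "kmult V T T = (\<lambda>x y. (\<Sum>g\<in>carrier G. \<Sum>h\<in>carrier G. kmult V (\<tau> h) (\<tau> g) x y) / N / N)"
    unfolding T_def kmult_scale_left kmult_scale_right kmult_sum_left kmult_sum_right
    by (intro ext) (simp, subst sum.swap, simp)
  also have "\<dots> = (\<lambda>x y. (\<Sum>g\<in>carrier G. \<Sum>h\<in>carrier G. \<tau> (h \<otimes> g) x y) / N / N)"
    using \<tau> by (simp add: krep_def)
  also have "\<dots> = (\<lambda>x y. (\<Sum>g\<in>carrier G. \<Sum>h\<in>carrier G. \<tau> h x y) / N / N)"
    using sum_translate_right[of _ "\<lambda>h. \<tau> h _ _"] by simp
  also have "\<dots> = T" using N by (simp add: T_def N_def order_def)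
  finally have TT: "kmult V T T = T" .
  have V: "finite V" and "kernel_on V V T" using \<tau> by (auto simp: krep_def kernel_on_def T_def)
  from ktr_idempotent[OF this TT] obtain k :: nat where k: "ktr V T = of_nat k" "k = 0 \<longrightarrow> T = (\<lambda>x y. 0)" by metis
  have "(\<Sum>g\<in>carrier G. ktr V (\<tau> g)) = N * ktr V T"
    using N unfolding ktr_def T_def by (subst sum.swap) (simp add: sum_divide_distrib[symmetric])
  moreover have "(\<Sum>g\<in>carrier G. \<tau> g x y) = 0" if "k = 0" for x y
    using that k(2) N by (auto simp: T_def fun_eq_iff)
  ultimately show thesis using that[of k] k(1) by (simp add: N_def)
qed

text \<open>This is the action \<open>X \<mapsto> \<rho>(g) X \<sigma>(g\<^sup>-\<^sup>1)\<close> on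
  linear maps from the space of \<open>\<sigma>\<close> to that of \<open>\<rho>\<close>, written in
  the basis of matrix units indexed by \<open>V \<times> W\<close>.\<close>

lemma krep_Hom:
  assumes r: "krep G V \<rho>" and s: "krep G W \<sigma>"
  shows "krep G (V \<times> W) (\<lambda>g p q. \<rho> g (fst p) (fst q) * \<sigma> (inv g) (snd q) (snd p))"
  unfolding krep_def
proof (intro conjI ballI ext)
  show "finite (V \<times> W)" using r s by (simp add: krep_def)
  show "kernel_on (V \<times> W) (V \<times> W) (\<lambda>p q. \<rho> g (fst p) (fst q) * \<sigma> (inv g) (snd q) (snd p))"
    if "g \<in> carrier G" for g
  proof -
    have "kernel_on V V (\<rho> g)" "kernel_on W W (\<sigma> (inv g))" using r s that by (auto simp: krep_def)
    then show ?thesis by (auto simp: kernel_on_def)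
  qed
  fix g h p q assume gh: "g \<in> carrier G" "h \<in> carrier G"
  have 1: "\<rho> (g \<otimes> h) = kmult V (\<rho> g) (\<rho> h)" "\<sigma> (inv (g \<otimes> h)) = kmult W (\<sigma> (inv h)) (\<sigma> (inv g))"
    using r s gh by (auto simp: krep_def inv_mult_group)
  show "\<rho> (g \<otimes> h) (fst p) (fst q) * \<sigma> (inv (g \<otimes> h)) (snd q) (snd p) =
     kmult (V \<times> W) (\<lambda>p q. \<rho> g (fst p) (fst q) * \<sigma> (inv g) (snd q) (snd p))
       (\<lambda>p q. \<rho> h (fst p) (fst q) * \<sigma> (inv h) (snd q) (snd p)) p q"
    unfolding 1 kmult_def sum_product sum.cartesian_product by (rule sum.cong) (auto simp: algebra_simps)
qed

lemma ktr_Hom: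
  "ktr (V \<times> W) (\<lambda>p q. A (fst p) (fst q) * B (snd q) (snd p)) = ktr V A * ktr W B"
  by (simp add: ktr_def sum_product sum.cartesian_product case_prod_unfold)

text \<open>The number \<open>k\<close> is the dimension of the space of intertwiners, obtained as
  the rank of the average on the Hom representation.\<close>

lemma character_pairing_nonneg:
  assumes fin: "finite (carrier G)" and "is_character G \<phi>" "is_character G \<psi>"
  obtains k :: nat where "(\<Sum>g\<in>carrier G. \<phi> g * \<psi> (inv g)) = of_nat (order G) * of_nat k"
proof -
  obtain n :: nat and \<rho> where r: "krep G {..<n} \<rho>" "\<And>g. g \<in> carrier G \<Longrightarrow> \<phi> g = ktr {..<n} (\<rho> g)"
    using is_characterE[OF assms(2)] by metis
  obtain m :: nat and \<sigma> where s: "krep G {..<m} \<sigma>" "\<And>g. g \<in> carrier G \<Longrightarrow> \<psi> g = ktr {..<m} (\<sigma> g)"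
    using is_characterE[OF assms(3)] by metis
  show thesis
  proof (rule krep_average[OF fin krep_Hom[OF r(1) s(1)], unfolded ktr_Hom])
    fix k :: nat
    assume "(\<Sum>g\<in>carrier G. ktr {..<n} (\<rho> g) * ktr {..<m} (\<sigma> (inv g))) = of_nat (order G) * of_nat k"
    then show thesis by (intro that[of k]) (simp add: r(2) s(2))
  qed
qed

text \<open>The identity map is a nonzero intertwiner. In coordinates, the entries of the summed Hom
  representation at \<open>((0,0),(y,y))\<close> add up over \<open>y\<close> to the group order, so
  one of them is nonzero and the rank is positive.\<close>

lemma character_pairing_self:
  assumes fin: "finite (carrier G)" and "is_character G \<phi>" and nz: "\<phi> \<one> \<noteq> 0"
  obtains k :: nat where "(\<Sum>g\<in>carrier G. \<phi> g * \<phi> (inv g)) = of_nat (order G) * of_nat k" "k > 0"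
proof -
  obtain n :: nat and \<rho> where r: "krep G {..<n} \<rho>" "\<rho> \<one> = kid {..<n}" "\<And>g. g \<in> carrier G \<Longrightarrow> \<phi> g = ktr {..<n} (\<rho> g)"
    using is_characterE[OF assms(2)] by metis
  have n: "n > 0" using nz r by (cases n) (auto simp: ktr_def)
  have *: "(\<Sum>y<n. \<Sum>g\<in>carrier G. \<rho> g 0 y * \<rho> (inv g) y 0) \<noteq> 0"
  proof -
    have "(\<Sum>y<n. \<Sum>g\<in>carrier G. \<rho> g 0 y * \<rho> (inv g) y 0) = (\<Sum>g\<in>carrier G. kmult {..<n} (\<rho> g) (\<rho> (inv g)) 0 0)"
      unfolding kmult_def by (rule sum.swap)
    also have "\<dots> = (\<Sum>g\<in>carrier G. \<rho> \<one> 0 0)"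
    proof (rule sum.cong[OF refl])
      fix g assume "g \<in> carrier G"
      then have "\<rho> (g \<otimes> inv g) = kmult {..<n} (\<rho> g) (\<rho> (inv g))" "g \<otimes> inv g = \<one>"
        using r(1) inv_closed unfolding krep_def by (blast, simp)
      then show "kmult {..<n} (\<rho> g) (\<rho> (inv g)) 0 0 = \<rho> \<one> 0 0" by simp
    qed
    also have "\<dots> = of_nat (order G)" using n by (simp add: r(2) kid_def order_def)
    finally show ?thesis using fin order_gt_0_iff_finite by simp
  qed
  then obtain y where y: "(\<Sum>g\<in>carrier G. \<rho> g 0 y * \<rho> (inv g) y 0) \<noteq> 0"
    by (meson sum.neutral)
  obtain k :: nat where "(\<Sum>g\<in>carrier G. \<phi> g * \<phi> (inv g)) = of_nat (order G) * of_nat k"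
     "k = 0 \<Longrightarrow> (\<Sum>g\<in>carrier G. \<rho> g 0 y * \<rho> (inv g) y 0) = 0"
  proof -
    obtain k :: nat where k: "(\<Sum>g\<in>carrier G. \<phi> g * \<phi> (inv g)) = of_nat (order G) * of_nat k"
      and z: "\<And>p q. k = 0 \<Longrightarrow> (\<Sum>g\<in>carrier G. \<rho> g (fst p) (fst q) * \<rho> (inv g) (snd q) (snd p)) = 0"
      using krep_average[OF fin krep_Hom[OF r(1) r(1)]] unfolding ktr_Hom by (auto simp: r(3))
    show thesis using that[OF k] z[of "(0, 0)" "(y, y)"] by simp
  qed
  with y that show thesis by blast
qed

section \<open>Intertwiners and common constituents\<close>

text \<open>A commuting idempotent \<open>e\<close> splits the action into the part cut out by
  \<open>e\<close> and the one cut out by \<open>1 - e\<close>. This is how the character of a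
  constituent is subtracted.\<close>

lemma krep_commuting_idempotent:
  assumes r: "krep G V \<rho>" and e: "kernel_on V V e" "kmult V e e = e"
    and comm: "\<And>g. g \<in> carrier G \<Longrightarrow> kmult V e (\<rho> g) = kmult V (\<rho> g) e"
  shows "krep G V (\<lambda>g. kmult V e (\<rho> g))" "krep G V (\<lambda>g x y. \<rho> g x y - kmult V e (\<rho> g) x y)"
proof -
  have V: "finite V" and K: "\<And>g. g \<in> carrier G \<Longrightarrow> kernel_on V V (\<rho> g)"
    and mul: "\<And>g h. g \<in> carrier G \<Longrightarrow> h \<in> carrier G \<Longrightarrow> kmult V (\<rho> g) (\<rho> h) = \<rho> (g \<otimes> h)"
    using r by (auto simp: krep_def)
  have eg: "kmult V (kmult V e (\<rho> g)) (kmult V e (\<rho> h)) = kmult V e (\<rho> (g \<otimes> h))"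
    "kmult V (\<rho> g) (kmult V e (\<rho> h)) = kmult V e (\<rho> (g \<otimes> h))"
    "kmult V (kmult V e (\<rho> g)) (\<rho> h) = kmult V e (\<rho> (g \<otimes> h))"
    if "g \<in> carrier G" "h \<in> carrier G" for g h
  proof -
    show 2: "kmult V (\<rho> g) (kmult V e (\<rho> h)) = kmult V e (\<rho> (g \<otimes> h))"
      using that by (metis comm kmult_assoc mul)
    show "kmult V (kmult V e (\<rho> g)) (\<rho> h) = kmult V e (\<rho> (g \<otimes> h))"
      using that by (simp add: kmult_assoc mul)
    show "kmult V (kmult V e (\<rho> g)) (kmult V e (\<rho> h)) = kmult V e (\<rho> (g \<otimes> h))"
      using 2 e(2) by (metis kmult_assoc)
  qed
  show "krep G V (\<lambda>g. kmult V e (\<rho> g))"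
    using V K e kernel_on_kmult by (auto simp: krep_def eg intro: kernel_on_kmult)
  show "krep G V (\<lambda>g x y. \<rho> g x y - kmult V e (\<rho> g) x y)"
    unfolding krep_def
  proof (intro conjI ballI V)
    fix g assume g: "g \<in> carrier G"
    show "kernel_on V V (\<lambda>x y. \<rho> g x y - kmult V e (\<rho> g) x y)"
      using K[OF g] kernel_on_kmult[OF e(1) K[OF g]] by (simp add: kernel_on_def)
  next
    fix g h assume "g \<in> carrier G" "h \<in> carrier G"
    then show "(\<lambda>x y. \<rho> (g \<otimes> h) x y - kmult V e (\<rho> (g \<otimes> h)) x y) =
      kmult V (\<lambda>x y. \<rho> g x y - kmult V e (\<rho> g) x y) (\<lambda>x y. \<rho> h x y - kmult V e (\<rho> h) x y)"
      by (simp add: kmult_diff_left kmult_diff_right eg mul)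
  qed
qed

text \<open>Reindexing the sum by \<open>h \<otimes> g\<close> moves the factor
  \<open>\<rho> h\<close> on the left to the factor \<open>\<sigma> h\<close> on the right.\<close>

lemma intertwiner_average:
  assumes r: "krep G V \<rho>" and s: "krep G W \<sigma>" and h: "h \<in> carrier G"
  shows "kmult V (\<rho> h) (\<lambda>x y. \<Sum>g\<in>carrier G. kmult V (\<rho> g) (kmult W T (\<sigma> (inv g))) x y)
     = kmult W (\<lambda>x y. \<Sum>g\<in>carrier G. kmult V (\<rho> g) (kmult W T (\<sigma> (inv g))) x y) (\<sigma> h)"
proof (intro ext)
  fix x y
  let ?F = "\<lambda>g. kmult V (\<rho> g) (kmult W T (\<sigma> (inv g \<otimes> h))) x y"
  have "kmult V (\<rho> h) (\<lambda>x y. \<Sum>g\<in>carrier G. kmult V (\<rho> g) (kmult W T (\<sigma> (inv g))) x y) x y = (\<Sum>g\<in>carrier G. ?F (h \<otimes> g))"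
    unfolding kmult_sum_right
  proof (rule sum.cong[OF refl])
    fix g assume g: "g \<in> carrier G"
    have "inv (h \<otimes> g) \<otimes> h = inv g" using g h by (simp add: inv_mult_group m_assoc)
    moreover have "\<rho> (h \<otimes> g) = kmult V (\<rho> h) (\<rho> g)" using r g h by (simp add: krep_def)
    ultimately show "kmult V (\<rho> h) (kmult V (\<rho> g) (kmult W T (\<sigma> (inv g)))) x y = ?F (h \<otimes> g)"
      by (simp only: kmult_assoc)
  qed
  also have "\<dots> = (\<Sum>g\<in>carrier G. ?F g)" by (rule sum_translate_left[OF h])
  also have "\<dots> = kmult W (\<lambda>x y. \<Sum>g\<in>carrier G. kmult V (\<rho> g) (kmult W T (\<sigma> (inv g))) x y) (\<sigma> h) x y"
    unfolding kmult_sum_left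
  proof (rule sum.cong[OF refl])
    fix g assume g: "g \<in> carrier G"
    have "\<sigma> (inv g \<otimes> h) = kmult W (\<sigma> (inv g)) (\<sigma> h)" using s g h by (simp add: krep_def)
    then show "?F g = kmult W (kmult V (\<rho> g) (kmult W T (\<sigma> (inv g)))) (\<sigma> h) x y"
      by (simp only: kmult_assoc)
  qed
  finally show "kmult V (\<rho> h) (\<lambda>x y. \<Sum>g\<in>carrier G. kmult V (\<rho> g) (kmult W T (\<sigma> (inv g))) x y) x y
     = kmult W (\<lambda>x y. \<Sum>g\<in>carrier G. kmult V (\<rho> g) (kmult W T (\<sigma> (inv g))) x y) (\<sigma> h) x y" .
qed

lemma kernel_on_average:
  assumes "krep G V \<rho>" "krep G W \<sigma>" "kernel_on V W T"
  shows "kernel_on V W (\<lambda>x y. \<Sum>g\<in>carrier G. kmult V (\<rho> g) (kmult W T (\<sigma> (inv g))) x y)"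
proof -
  have "kernel_on V W (kmult V (\<rho> g) (kmult W T (\<sigma> (inv g))))" if "g \<in> carrier G" for g
    using assms that by (auto simp: krep_def intro!: kernel_on_kmult)
  then show ?thesis by (simp add: kernel_on_def)
qed

text \<open>Averaging a generalized inverse of a nonzero intertwiner \<open>M\<close> gives an intertwiner \<open>N\<close> with
  \<open>M N M = M\<close>; the idempotents \<open>N M\<close> and \<open>M N\<close> cut out isomorphic subrepresentations.\<close>

lemma common_constituent:
  assumes fin: "finite (carrier G)" and "is_character G \<phi>" "is_character G \<psi>"
    and nz: "(\<Sum>g\<in>carrier G. \<phi> g * \<psi> (inv g)) \<noteq> 0"
  obtains \<theta> where "is_character G \<theta>" "is_character G (\<lambda>g. \<phi> g - \<theta> g)" "is_character G (\<lambda>g. \<psi> g - \<theta> g)" "\<theta> \<one> \<noteq> 0"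
proof -
  obtain n :: nat and \<rho> where r: "krep G {..<n} \<rho>" "\<rho> \<one> = kid {..<n}" "\<And>g. g \<in> carrier G \<Longrightarrow> \<phi> g = ktr {..<n} (\<rho> g)"
    using is_characterE[OF assms(2)] by metis
  obtain m :: nat and \<sigma> where s: "krep G {..<m} \<sigma>" "\<sigma> \<one> = kid {..<m}" "\<And>g. g \<in> carrier G \<Longrightarrow> \<psi> g = ktr {..<m} (\<sigma> g)"
    using is_characterE[OF assms(3)] by metis
  let ?V = "{..<n}" and ?W = "{..<m}"
  define N0 :: complex where "N0 = of_nat (order G)"
  have N0: "N0 \<noteq> 0" using fin order_gt_0_iff_finite by (simp add: N0_def)
  have ms: "\<And>g h. g \<in> carrier G \<Longrightarrow> h \<in> carrier G \<Longrightarrow> kmult ?W (\<sigma> g) (\<sigma> h) = \<sigma> (g \<otimes> h)"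
    using s by (auto simp: krep_def)
  have "(\<Sum>g\<in>carrier G. \<phi> g * \<psi> (inv g)) = (\<Sum>g\<in>carrier G. \<Sum>x<n. \<Sum>y<m. \<rho> g x x * \<sigma> (inv g) y y)"
    by (simp add: r(3) s(3) ktr_def sum_product)
  also have "\<dots> = (\<Sum>x<n. \<Sum>g\<in>carrier G. \<Sum>y<m. \<rho> g x x * \<sigma> (inv g) y y)" by (rule sum.swap)
  also have "\<dots> = (\<Sum>x<n. \<Sum>y<m. \<Sum>g\<in>carrier G. \<rho> g x x * \<sigma> (inv g) y y)" by (simp only: sum.swap[of _ "carrier G"])
  finally have "(\<Sum>x<n. \<Sum>y<m. \<Sum>g\<in>carrier G. \<rho> g x x * \<sigma> (inv g) y y) \<noteq> 0" using nz by simp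
  then obtain x0 where "x0 \<in> {..<n}" "(\<Sum>y<m. \<Sum>g\<in>carrier G. \<rho> g x0 x0 * \<sigma> (inv g) y y) \<noteq> 0"
    by (rule sum.not_neutral_contains_not_neutral)
  moreover then obtain y0 where "y0 \<in> {..<m}" "(\<Sum>g\<in>carrier G. \<rho> g x0 x0 * \<sigma> (inv g) y0 y0) \<noteq> 0"
    using sum.not_neutral_contains_not_neutral by blast
  ultimately have xy0: "x0 < n" "y0 < m" and xy: "(\<Sum>g\<in>carrier G. \<rho> g x0 x0 * \<sigma> (inv g) y0 y0) \<noteq> 0" by auto
  \<comment> \<open>The pairing is a sum over pairs of diagonal positions, so some pair
    \<open>(x0, y0)\<close> contributes a nonzero amount. Averaging the matrix unit at that pair
    gives an intertwiner \<open>M\<close> whose entry at \<open>(x0, y0)\<close> is exactly this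
    contribution.\<close>
  define T :: "nat \<Rightarrow> nat \<Rightarrow> complex" where "T = (\<lambda>x y. if x = x0 \<and> y = y0 then 1 else 0)"
  define M where "M = (\<lambda>x y. \<Sum>g\<in>carrier G. kmult ?V (\<rho> g) (kmult ?W T (\<sigma> (inv g))) x y)"
  have KM: "kernel_on ?V ?W M"
    unfolding M_def by (rule kernel_on_average[OF r(1) s(1)]) (use xy0 in \<open>auto simp: T_def kernel_on_def\<close>)
  have Mnz: "M x0 y0 \<noteq> 0"
  proof -
    have "kmult ?W T B = (\<lambda>x y. if x = x0 then B y0 y else 0)" for B :: "nat \<Rightarrow> nat \<Rightarrow> complex"
      using xy0 by (intro ext) (auto simp: kmult_def T_def if_distrib[of "\<lambda>u. u * _"] cong: if_cong)
    then have "M x0 y0 = (\<Sum>g\<in>carrier G. \<rho> g x0 x0 * \<sigma> (inv g) y0 y0)"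
      using xy0 by (simp add: M_def kmult_def if_distrib[of "(*) _"] cong: if_cong)
    then show ?thesis using xy by simp
  qed
  have Mh: "kmult ?V (\<rho> h) M = kmult ?W M (\<sigma> h)" if "h \<in> carrier G" for h
    unfolding M_def using that by (rule intertwiner_average[OF r(1) s(1)])
  obtain M0 where M0: "kernel_on ?W ?V M0" "kmult ?V (kmult ?W M M0) M = M"
    using generalized_inverse[OF _ _ KM] by auto
  define A where "A = (\<lambda>x y. \<Sum>g\<in>carrier G. kmult ?W (\<sigma> g) (kmult ?V M0 (\<rho> (inv g))) x y)"
  define N where "N = (\<lambda>x y. A x y / N0)"
  have KN: "kernel_on ?W ?V N"
    using kernel_on_average[OF s(1) r(1) M0(1)] by (simp add: N_def A_def kernel_on_def)
  have Nh: "kmult ?W (\<sigma> h) N = kmult ?V N (\<rho> h)" if "h \<in> carrier G" for h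
    unfolding N_def A_def kmult_scale_left kmult_scale_right
    by (simp only: intertwiner_average[OF s(1) r(1) that])
  \<comment> \<open>Every summand of \<open>A\<close> is itself a generalized inverse of
    \<open>M\<close>: moving \<open>\<sigma> g\<close> and \<open>\<rho> (inv g)\<close> across the
    intertwiner \<open>M\<close> reduces it to \<open>M M0 M\<close> and lets the group elements
    cancel. Division by the group order then gives \<open>N\<close>.\<close>
  have "kmult ?V (kmult ?W M A) M = (\<lambda>x y. N0 * M x y)"
  proof -
    have "kmult ?V (kmult ?W M (kmult ?W (\<sigma> g) (kmult ?V M0 (\<rho> (inv g))))) M = M" if g: "g \<in> carrier G" for g
    proof -
      have "kmult ?V (kmult ?W M (kmult ?W (\<sigma> g) (kmult ?V M0 (\<rho> (inv g))))) M =
        kmult ?V (kmult ?W (kmult ?W M (\<sigma> g)) M0) (kmult ?V (\<rho> (inv g)) M)" by (simp only: kmult_assoc)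
      also have "\<dots> = kmult ?V (\<rho> g) (kmult ?W (kmult ?V (kmult ?W M M0) M) (\<sigma> (inv g)))"
        using g by (simp only: Mh[symmetric] inv_closed) (simp only: kmult_assoc Mh[OF inv_closed])
      also have "\<dots> = kmult ?W (kmult ?V (\<rho> g) M) (\<sigma> (inv g))" by (simp only: M0(2)) (simp only: kmult_assoc)
      also have "\<dots> = kmult ?W M (kmult ?W (\<sigma> g) (\<sigma> (inv g)))" using g by (simp only: Mh kmult_assoc)
      also have "\<dots> = M" using g kmult_kid_right[OF _ KM] by (simp add: ms s(2))
      finally show ?thesis .
    qed
    then show ?thesis
      unfolding A_def kmult_sum_left kmult_sum_right by (simp add: N0_def order_def)
  qed
  then have MNM: "kmult ?V (kmult ?W M N) M = M"
    using N0 by (simp add: N_def kmult_scale_left kmult_scale_right)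
  define e where "e = kmult ?V N M"
  define f where "f = kmult ?W M N"
  have Ke: "kernel_on ?W ?W e" and Kf: "kernel_on ?V ?V f"
    unfolding e_def f_def using kernel_on_kmult KM KN by blast+
  have "kmult ?W e e = kmult ?V N (kmult ?V (kmult ?W M N) M)" unfolding e_def by (simp only: kmult_assoc)
  then have ee: "kmult ?W e e = e" by (simp only: MNM e_def)
  have "kmult ?V f f = kmult ?W (kmult ?V (kmult ?W M N) M) N" unfolding f_def by (simp only: kmult_assoc)
  then have ff: "kmult ?V f f = f" by (simp only: MNM f_def)
  have eh: "kmult ?W e (\<sigma> h) = kmult ?W (\<sigma> h) e" if "h \<in> carrier G" for h
  proof -
    have "kmult ?W e (\<sigma> h) = kmult ?V (kmult ?V N (\<rho> h)) M" unfolding e_def by (simp only: kmult_assoc Mh[OF that])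
    then show ?thesis unfolding e_def by (simp only: Nh[OF that, symmetric]) (simp only: kmult_assoc)
  qed
  have fh: "kmult ?V f (\<rho> h) = kmult ?V (\<rho> h) f" if "h \<in> carrier G" for h
  proof -
    have "kmult ?V f (\<rho> h) = kmult ?W (kmult ?W M (\<sigma> h)) N" unfolding f_def by (simp only: kmult_assoc Nh[OF that])
    then show ?thesis unfolding f_def by (simp only: Mh[OF that, symmetric]) (simp only: kmult_assoc)
  qed
  \<comment> \<open>As \<open>f = M N\<close> and \<open>e = N M\<close>, cyclicity of the trace
    shows that both idempotents cut out the same character.\<close>
  have tr: "ktr ?V (kmult ?V f (\<rho> h)) = ktr ?W (kmult ?W e (\<sigma> h))" if "h \<in> carrier G" for h
  proof -
    have "ktr ?V (kmult ?V f (\<rho> h)) = ktr ?V (kmult ?W M (kmult ?V N (\<rho> h)))" unfolding f_def by (simp only: kmult_assoc)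
    also have "\<dots> = ktr ?W (kmult ?V (kmult ?V N (\<rho> h)) M)" by (rule ktr_kmult_commute)
    also have "\<dots> = ktr ?W (kmult ?W e (\<sigma> h))" unfolding e_def by (simp only: kmult_assoc Mh[OF that])
    finally show ?thesis .
  qed
  note E = krep_commuting_idempotent[OF s(1) Ke ee eh] and F = krep_commuting_idempotent[OF r(1) Kf ff fh]
  show thesis
  proof
    show "is_character G (\<lambda>g. ktr ?W (kmult ?W e (\<sigma> g)))" by (rule krep_is_character[OF E(1)])
    show "is_character G (\<lambda>g. \<psi> g - ktr ?W (kmult ?W e (\<sigma> g)))"
      by (rule is_character_cong[OF krep_is_character[OF E(2)]]) (simp_all add: ktr_diff s(3))
    show "is_character G (\<lambda>g. \<phi> g - ktr ?W (kmult ?W e (\<sigma> g)))"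
      by (rule is_character_cong[OF krep_is_character[OF F(2)]]) (simp_all add: ktr_diff r(3) tr)
    \<comment> \<open>The degree of the constituent is the rank of \<open>e\<close>, which is
      positive because \<open>M e = M\<close> is nonzero.\<close>
    have "e \<noteq> (\<lambda>x y. 0)"
    proof
      assume "e = (\<lambda>x y. 0)"
      then have "kmult ?W M e = (\<lambda>x y. 0)" by (simp add: kmult_def)
      moreover have "kmult ?W M e = M" unfolding e_def using MNM by (simp only: kmult_assoc)
      ultimately show False using Mnz by simp
    qed
    then have "ktr ?W e \<noteq> 0" using ktr_idempotent[OF _ Ke ee] by (metis finite_lessThan of_nat_eq_0_iff)
    then show "ktr ?W (kmult ?W e (\<sigma> \<one>)) \<noteq> 0" using kmult_kid_right[OF _ Ke] by (simp add: s(2))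
  qed
qed

text \<open>Subtracting common constituents from \<open>\<alpha>\<close> and \<open>\<beta>\<close> reduces to \<open>\<beta> = 0\<close>; as long as \<open>\<beta>\<close> is nonzero there
  is one, because \<open>\<alpha> = \<gamma> / m + \<beta>\<close> pairs positively with \<open>\<beta>\<close>.\<close>

lemma is_character_diff:
  assumes fin: "finite (carrier G)" and m: "m > 0"
    and "is_character G \<alpha>" "is_character G \<beta>" and \<gamma>: "is_character G (\<lambda>g. of_nat m * (\<alpha> g - \<beta> g))"
  shows "is_character G (\<lambda>g. \<alpha> g - \<beta> g)"
proof -
  \<comment> \<open>Degrees are natural numbers and only the zero character has degree 0, so the
    induction can run on the degree of \<open>\<beta>\<close>.\<close>
  have deg: "\<exists>n. \<phi> \<one> = of_nat n \<and> (n = 0 \<longrightarrow> (\<forall>g\<in>carrier G. \<phi> g = 0))" if \<phi>: "is_character G \<phi>" for \<phi> :: "'a \<Rightarrow> complex"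
  proof -
    obtain n :: nat and \<rho> where "krep G {..<n} \<rho>" "\<rho> \<one> = kid {..<n}" "\<And>g. g \<in> carrier G \<Longrightarrow> \<phi> g = ktr {..<n} (\<rho> g)"
      using is_characterE[OF \<phi>] by metis
    then show ?thesis by (intro exI[of _ n]) (auto simp: ktr_kid ktr_def[of "{}"])
  qed
  obtain n where "\<beta> \<one> = of_nat n" using deg assms(4) by blast
  then show ?thesis using assms(3-5)
  proof (induction n arbitrary: \<alpha> \<beta> rule: less_induct)
    case (less n)
    show ?case
    proof (cases "n = 0")
      case True
      then have "\<forall>g\<in>carrier G. \<beta> g = 0" using deg[OF less.prems(3)] less.prems(1) by auto
      then show ?thesis by (intro is_character_cong[OF less.prems(2)]) simp
    next
      case False
      obtain k where k: "(\<Sum>g\<in>carrier G. \<beta> g * \<beta> (inv g)) = of_nat (order G) * of_nat k" "k > 0"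
        using character_pairing_self[OF fin less.prems(3)] False less.prems(1) by auto
      obtain l where l: "(\<Sum>g\<in>carrier G. (of_nat m * (\<alpha> g - \<beta> g)) * \<beta> (inv g)) = of_nat (order G) * of_nat l"
        using character_pairing_nonneg[OF fin less.prems(4,3)] by auto
      have "of_nat m * (\<Sum>g\<in>carrier G. \<alpha> g * \<beta> (inv g)) =
        (\<Sum>g\<in>carrier G. (of_nat m * (\<alpha> g - \<beta> g)) * \<beta> (inv g)) + of_nat m * (\<Sum>g\<in>carrier G. \<beta> g * \<beta> (inv g))"
        by (simp add: sum_distrib_left sum.distrib[symmetric] algebra_simps)
      also have "\<dots> = of_nat (order G * (l + m * k))" unfolding k l by (simp add: algebra_simps)
      also have "\<dots> \<noteq> 0" using k(2) m fin order_gt_0_iff_finite by (simp only: of_nat_eq_0_iff) simp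
      finally have "(\<Sum>g\<in>carrier G. \<alpha> g * \<beta> (inv g)) \<noteq> 0" by auto
      then obtain \<theta> where \<theta>: "is_character G \<theta>" "is_character G (\<lambda>g. \<alpha> g - \<theta> g)" "is_character G (\<lambda>g. \<beta> g - \<theta> g)" "\<theta> \<one> \<noteq> 0"
        using common_constituent[OF fin less.prems(2,3)] by metis
      obtain a b where ab: "\<theta> \<one> = of_nat a" "\<beta> \<one> - \<theta> \<one> = of_nat b" using deg[OF \<theta>(1)] deg[OF \<theta>(3)] by auto
      have "of_nat n = (of_nat (a + b) :: complex)" using ab less.prems(1) by (simp add: algebra_simps)
      then have "n = a + b" by (simp only: of_nat_eq_iff)
      then have "b < n" using ab \<theta>(4) by auto
      from less.IH[OF this ab(2) \<theta>(2,3)] show ?thesis using less.prems(4) by simp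
    qed
  qed
qed

section \<open>Characters from integer multiples\<close>

lemma is_character_of_nat_mult:
  assumes "is_character G \<phi>"
  shows "is_character G (\<lambda>g. of_nat n * \<phi> g)"
  using is_character_sum[of "{..<n}" "\<lambda>_. \<phi>"] assms by simp

text \<open>Bezout in the form \<open>a * m = b * n + 1\<close>, with natural coefficients, writes
  \<open>\<phi>\<close> as the difference of the characters \<open>a m \<phi>\<close> and
  \<open>b n \<phi>\<close>. Since \<open>m \<phi>\<close> is also a character,
  \<open>is_character_diff\<close> applies.\<close>

lemma is_character_coprime_multiples:
  assumes fin: "finite (carrier G)" and cop: "coprime m n" and m: "m > 0"
    and cm: "is_character G (\<lambda>g. of_nat m * \<phi> g)" and cn: "is_character G (\<lambda>g. of_nat n * \<phi> g)"
  shows "is_character G \<phi>"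
proof -
  obtain a b where ab: "a * m = b * n + 1"
    using bezout_nat[of m n] m cop by (metis coprime_imp_gcd_eq_1 gr_implies_not0 mult.commute)
  let ?\<alpha> = "\<lambda>g. of_nat a * (of_nat m * \<phi> g)" and ?\<beta> = "\<lambda>g. of_nat b * (of_nat n * \<phi> g)"
  have d: "?\<alpha> g - ?\<beta> g = \<phi> g" for g
  proof -
    have "?\<alpha> g - ?\<beta> g = (of_nat (a * m) - of_nat (b * n)) * \<phi> g" by (simp add: algebra_simps)
    then show ?thesis by (simp only: ab) simp
  qed
  have "is_character G (\<lambda>g. ?\<alpha> g - ?\<beta> g)"
    by (rule is_character_diff[OF fin m])
      (use cm in \<open>simp_all only: d is_character_of_nat_mult[OF cm] is_character_of_nat_mult[OF cn]\<close>)
  then show ?thesis by (simp only: d)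
qed


section \<open>The group algebra\<close>

lemma commutator_in_derived:
  assumes "g \<in> carrier G" "h \<in> carrier G"
  shows "g \<otimes> h \<otimes> inv g \<otimes> inv h \<in> derived G (carrier G)"
  unfolding derived_def using assms by (intro generate.incl) blast

text \<open>The conjugate equals the commutator of \<open>inv x\<close> and \<open>n\<close>
  multiplied by \<open>n\<close>.\<close>

lemma derived_conj_closed:
  assumes x: "x \<in> carrier G" and n: "n \<in> derived G (carrier G)"
  shows "inv x \<otimes> n \<otimes> x \<in> derived G (carrier G)"
proof -
  have n': "n \<in> carrier G" using n derived_in_carrier[of "carrier G"] by blast
  have "inv x \<otimes> n \<otimes> x \<otimes> inv n \<otimes> n \<in> derived G (carrier G)"
    using commutator_in_derived[of "inv x" n] x n n' subgroup.m_closed[OF derived_is_subgroup[OF order_refl]] by simp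
  then show ?thesis using x n' by (simp add: m_assoc)
qed

lemma sum_subgroup_translate:
  assumes H: "subgroup H G" and h: "h \<in> H"
  shows "(\<Sum>n\<in>H. f (h \<otimes> n)) = (\<Sum>n\<in>H. f n)"
proof -
  have c: "\<And>n. n \<in> H \<Longrightarrow> n \<in> carrier G" by (rule subgroup.mem_carrier[OF H])
  show ?thesis
    by (rule sum.reindex_bij_witness[of _ "\<lambda>g. inv h \<otimes> g" "\<lambda>g. h \<otimes> g"])
      (use H h c in \<open>auto simp: m_assoc[symmetric] subgroup.m_closed subgroup.m_inv_closed\<close>)
qed

text \<open>Left and right cosets of the normal subgroup agree. This makes averaging over its cosets
  central in the group algebra.\<close>

lemma sum_derived_coset_commute:
  assumes x: "x \<in> carrier G"
  shows "(\<Sum>n\<in>derived G (carrier G). f (n \<otimes> x)) = (\<Sum>n\<in>derived G (carrier G). f (x \<otimes> n))"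
proof -
  have c: "\<And>n. n \<in> derived G (carrier G) \<Longrightarrow> n \<in> carrier G" using derived_in_carrier[of "carrier G"] by blast
  show ?thesis
    by (rule sum.reindex_bij_witness[of _ "\<lambda>n. x \<otimes> n \<otimes> inv x" "\<lambda>n. inv x \<otimes> n \<otimes> x"])
      (use x c derived_conj_closed[of x] derived_conj_closed[of "inv x"] in
        \<open>auto simp: m_assoc[symmetric]\<close>, auto simp: m_assoc)
qed

section \<open>Convolution, idempotents and conjugation counts\<close>

definition convolve :: "('a \<Rightarrow> complex) \<Rightarrow> ('a \<Rightarrow> complex) \<Rightarrow> 'a \<Rightarrow> complex" where
  "convolve a b g = (\<Sum>h\<in>carrier G. a h * b (inv h \<otimes> g))"

text \<open>Inversion is an anti-automorphism of the group algebra. Indicators of subgroups are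
  invariant under it, so a product of two of them determines the product in the other order.\<close>

lemma convolve_reverse:
  assumes g: "g \<in> carrier G" and "\<And>h. h \<in> carrier G \<Longrightarrow> a (inv h) = a h" "\<And>h. h \<in> carrier G \<Longrightarrow> b (inv h) = b h"
  shows "convolve b a g = convolve a b (inv g)"
proof -
  have "convolve b a g = (\<Sum>h\<in>carrier G. b (g \<otimes> h) * a (inv (g \<otimes> h) \<otimes> g))"
    unfolding convolve_def using g by (intro sum_translate_left[symmetric])
  also have "\<dots> = (\<Sum>h\<in>carrier G. a h * b (inv h \<otimes> inv g))"
  proof (rule sum.cong[OF refl])
    fix h assume h: "h \<in> carrier G"
    have "inv (g \<otimes> h) \<otimes> g = inv h" using g h by (simp add: inv_mult_group m_assoc)
    moreover have "b (g \<otimes> h) = b (inv h \<otimes> inv g)" using assms(3)[of "g \<otimes> h"] g h by (simp add: inv_mult_group)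
    ultimately show "b (g \<otimes> h) * a (inv (g \<otimes> h) \<otimes> g) = a h * b (inv h \<otimes> inv g)" using assms(2) h by simp
  qed
  finally show ?thesis by (simp add: convolve_def)
qed

lemma convolve_assoc:
  assumes g: "g \<in> carrier G"
  shows "convolve (convolve a b) c g = convolve a (convolve b c) g"
proof -
  have "convolve (convolve a b) c g = (\<Sum>k\<in>carrier G. \<Sum>h\<in>carrier G. a k * b (inv k \<otimes> h) * c (inv h \<otimes> g))"
    unfolding convolve_def sum_distrib_right by (rule sum.swap)
  also have "\<dots> = (\<Sum>k\<in>carrier G. \<Sum>h\<in>carrier G. a k * b (inv k \<otimes> (k \<otimes> h)) * c (inv (k \<otimes> h) \<otimes> g))"
    by (intro sum.cong refl sum_translate_left[symmetric])
  also have "\<dots> = (\<Sum>k\<in>carrier G. \<Sum>h\<in>carrier G. a k * (b h * c (inv h \<otimes> (inv k \<otimes> g))))"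
    using g by (intro sum.cong refl) (simp add: m_assoc[symmetric] inv_mult_group mult.assoc)
  finally show ?thesis by (simp add: convolve_def sum_distrib_left)
qed

text \<open>The kernel \<open>K g\<close> is left translation by \<open>g\<close> followed by the
  operator with kernel \<open>E (inv u \<otimes> v)\<close>, which commutes with left translations.
  Multiplicativity of \<open>K\<close> therefore reduces to \<open>E\<close> being idempotent, and
  \<open>K \<one>\<close> is in general only a projection, as \<open>krep\<close> permits.\<close>

lemma is_character_idempotent:
  assumes fin: "finite (carrier G)" and E: "\<And>g. g \<in> carrier G \<Longrightarrow> convolve E E g = E g"
  shows "is_character G (\<lambda>g. \<Sum>x\<in>carrier G. E (inv x \<otimes> g \<otimes> x))"
proof -
  define K where "K g = (\<lambda>u v. if u \<in> carrier G \<and> v \<in> carrier G then E (inv u \<otimes> g \<otimes> v) else 0)" for g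
  have "krep G (carrier G) K"
    unfolding krep_def
  proof (intro conjI ballI ext fin)
    show "kernel_on (carrier G) (carrier G) (K g)" for g by (auto simp: kernel_on_def K_def)
    fix g h u w assume gh: "g \<in> carrier G" "h \<in> carrier G"
    show "K (g \<otimes> h) u w = kmult (carrier G) (K g) (K h) u w"
    proof (cases "u \<in> carrier G \<and> w \<in> carrier G")
      case True
      then have "K (g \<otimes> h) u w = convolve E E (inv u \<otimes> (g \<otimes> h) \<otimes> w)" using gh E by (simp add: K_def)
      also have "\<dots> = (\<Sum>v\<in>carrier G. E (inv u \<otimes> g \<otimes> v) * E (inv (inv u \<otimes> g \<otimes> v) \<otimes> (inv u \<otimes> (g \<otimes> h) \<otimes> w)))"
        unfolding convolve_def using True gh by (intro sum_translate_left[symmetric]) simp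
      also have "\<dots> = kmult (carrier G) (K g) (K h) u w"
        unfolding kmult_def
      proof (rule sum.cong[OF refl])
        fix v assume v: "v \<in> carrier G"
        have "inv (inv u \<otimes> g \<otimes> v) \<otimes> (inv u \<otimes> (g \<otimes> h) \<otimes> w) = inv v \<otimes> h \<otimes> w"
          using True gh v by (simp add: inv_mult_group m_assoc) (simp add: m_assoc[symmetric])
        then show "E (inv u \<otimes> g \<otimes> v) * E (inv (inv u \<otimes> g \<otimes> v) \<otimes> (inv u \<otimes> (g \<otimes> h) \<otimes> w)) = K g u v * K h v w"
          using True v by (simp add: K_def)
      qed
      finally show ?thesis .
    next
      case False
      then show ?thesis by (auto simp: K_def kmult_def)
    qed
  qed
  from krep_is_character[OF this] show ?thesis by (rule is_character_cong) (simp add: ktr_def K_def)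
qed

text \<open>The fibre of \<open>x \<mapsto> inv x \<otimes> g \<otimes> x\<close> over a conjugate
  \<open>h \<otimes> g \<otimes> inv h\<close> is the coset of the centralizer through
  \<open>inv h\<close>, so all fibres have the same size.\<close>

lemma card_conjugators_into:
  assumes fin: "finite (carrier G)" and g: "g \<in> carrier G"
  shows "card {x \<in> carrier G. inv x \<otimes> g \<otimes> x \<in> A} = card (centralizer_el G g) * card (A \<inter> conj_class G g)"
proof -
  let ?f = "\<lambda>x. inv x \<otimes> g \<otimes> x"
  let ?S = "{x \<in> carrier G. ?f x \<in> A}"
  have img: "?f ` ?S \<subseteq> A \<inter> conj_class G g"
  proof
    fix k assume "k \<in> ?f ` ?S"
    then obtain x where x: "x \<in> carrier G" "?f x \<in> A" "k = ?f x" by blast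
    then have "k \<in> conj_class G g" unfolding conj_class_def by (intro CollectI exI[of _ "inv x"]) simp
    with x show "k \<in> A \<inter> conj_class G g" by simp
  qed
  have fT: "finite (conj_class G g)"
    using fin by (simp add: conj_class_def Setcompr_eq_image)
  have fib: "card {x \<in> ?S. ?f x = k} = card (centralizer_el G g)" if k: "k \<in> A \<inter> conj_class G g" for k
  proof -
    from k obtain h where h: "h \<in> carrier G" "k = h \<otimes> g \<otimes> inv h" by (auto simp: conj_class_def)
    have "bij_betw (\<lambda>c. c \<otimes> inv h) (centralizer_el G g) {x \<in> ?S. ?f x = k}"
    proof (rule bij_betwI[where g = "\<lambda>x. x \<otimes> h"])
      show "(\<lambda>c. c \<otimes> inv h) \<in> centralizer_el G g \<rightarrow> {x \<in> ?S. ?f x = k}"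
      proof
        fix c assume "c \<in> centralizer_el G g"
        then have c: "c \<in> carrier G" "c \<otimes> g = g \<otimes> c" by (auto simp: centralizer_el_def)
        have "inv c \<otimes> g \<otimes> c = g" using c g by (metis inv_solve_left m_assoc m_closed inv_closed)
        moreover have "?f (c \<otimes> inv h) = h \<otimes> (inv c \<otimes> g \<otimes> c) \<otimes> inv h"
          using c(1) h(1) g by (simp add: inv_mult_group m_assoc)
        ultimately have fk: "?f (c \<otimes> inv h) = k" by (simp only: h(2))
        show "c \<otimes> inv h \<in> {x \<in> ?S. ?f x = k}"
          unfolding mem_Collect_eq fk using k c(1) h(1) by (intro conjI refl m_closed inv_closed) blast+
      qed
      show "(\<lambda>x. x \<otimes> h) \<in> {x \<in> ?S. ?f x = k} \<rightarrow> centralizer_el G g"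
      proof
        fix x assume "x \<in> {x \<in> ?S. ?f x = k}"
        then have x: "x \<in> carrier G" "inv x \<otimes> g \<otimes> x = h \<otimes> g \<otimes> inv h" by (simp, simp only: mem_Collect_eq h(2))
        have "x \<otimes> h \<otimes> g = x \<otimes> (h \<otimes> g \<otimes> inv h) \<otimes> h" using x(1) h(1) g by (simp add: m_assoc)
        also have "\<dots> = x \<otimes> (inv x \<otimes> g \<otimes> x) \<otimes> h" by (simp add: x(2))
        also have "\<dots> = g \<otimes> (x \<otimes> h)" using x(1) h(1) g by (simp add: m_assoc[symmetric])
        finally show "x \<otimes> h \<in> centralizer_el G g" using x(1) h(1) by (simp add: centralizer_el_def)
      qed
    qed (use h g in \<open>auto simp: centralizer_el_def m_assoc\<close>)
    then show ?thesis by (simp add: bij_betw_same_card)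
  qed
  have "card ?S = (\<Sum>k\<in>A \<inter> conj_class G g. \<Sum>x\<in>{x \<in> ?S. ?f x = k}. 1)"
    using sum.group[OF _ _ img, of "\<lambda>_. 1::nat"] fin fT by simp
  also have "\<dots> = (\<Sum>k\<in>A \<inter> conj_class G g. card (centralizer_el G g))"
    by (intro sum.cong refl) (use fib in auto)
  finally show ?thesis by (simp add: mult.commute)
qed

text \<open>Averaging over the cosets of the derived subgroup is multiplication by a central idempotent, which
  fixes constant functions; subtracting the average of \<open>a\<close> therefore removes the constant \<open>c\<close>.\<close>

lemma is_character_quasi_idempotent:
  fixes a :: "'a \<Rightarrow> complex"
  defines "N \<equiv> derived G (carrier G)"
  assumes fin: "finite (carrier G)" and k: "k \<noteq> 0"
    and a: "\<And>g. g \<in> carrier G \<Longrightarrow> convolve a a g = k * a g + c"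
  shows "is_character G (\<lambda>g. ((\<Sum>x\<in>carrier G. a (inv x \<otimes> g \<otimes> x)) - of_nat (card (rcosets N)) * (\<Sum>h\<in>g <# N. a h)) / k)"
proof -
  have N: "subgroup N G" unfolding N_def by (rule derived_is_subgroup[OF order_refl])
  have NG: "n \<in> carrier G" if "n \<in> N" for n using that by (rule subgroup.mem_carrier[OF N])
  have finN: "finite N" by (rule finite_subset[OF _ fin]) (use NG in auto)
  define d :: complex where "d = of_nat (card N)"
  have d: "d \<noteq> 0" using finN subgroup.one_closed[OF N] by (auto simp: d_def)
  define av where "av f g = (\<Sum>n\<in>N. f (g \<otimes> n)) / d" for f :: "'a \<Rightarrow> complex" and g
  have av_trans: "av f (g \<otimes> m) = av f g" if "g \<in> carrier G" "m \<in> N" for f g m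
  proof -
    have "(\<Sum>n\<in>N. f (g \<otimes> m \<otimes> n)) = (\<Sum>n\<in>N. f (g \<otimes> (m \<otimes> n)))"
      using that NG by (intro sum.cong refl) (simp add: m_assoc)
    also have "\<dots> = (\<Sum>n\<in>N. f (g \<otimes> n))" by (rule sum_subgroup_translate[OF N that(2)])
    finally show ?thesis by (simp add: av_def)
  qed
  have av_av: "av (av f) g = av f g" if "g \<in> carrier G" for f g
    using that d by (simp add: av_def[of "av f"] av_trans d_def)
  have conv_av: "convolve f (av h) g = av (convolve f h) g" if g: "g \<in> carrier G" for f h g
  proof -
    have "convolve f (av h) g = (\<Sum>x\<in>carrier G. \<Sum>n\<in>N. f x * h (inv x \<otimes> (g \<otimes> n))) / d"
      using g NG by (simp add: convolve_def av_def sum_distrib_left sum_divide_distrib m_assoc)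
    also have "\<dots> = av (convolve f h) g"
      unfolding av_def convolve_def by (subst sum.swap) rule
    finally show ?thesis .
  qed
  have av_conv: "convolve (av f) h g = convolve f (av h) g" if g: "g \<in> carrier G" for f h g
  proof -
    have "convolve (av f) h g = (\<Sum>n\<in>N. \<Sum>x\<in>carrier G. f (x \<otimes> n) * h (inv x \<otimes> g)) / d"
      unfolding convolve_def av_def
      by (subst sum.swap) (simp add: sum_distrib_right sum_divide_distrib)
    \<comment> \<open>Inserting \<open>n \<otimes> inv n\<close> makes the summand a function of
      \<open>x \<otimes> n\<close> and \<open>n\<close>, so translating \<open>x\<close> frees
      \<open>f\<close> from \<open>n\<close>. Normality then moves the average to the right of the
      argument of \<open>h\<close>.\<close>
    also have "\<dots> = (\<Sum>n\<in>N. \<Sum>x\<in>carrier G. f (x \<otimes> n) * h (n \<otimes> (inv (x \<otimes> n) \<otimes> g))) / d"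
      using g NG by (intro arg_cong[of _ _ "\<lambda>u. u / d"] sum.cong refl)
        (simp add: inv_mult_group m_assoc[symmetric])
    also have "\<dots> = (\<Sum>n\<in>N. \<Sum>x\<in>carrier G. f x * h (n \<otimes> (inv x \<otimes> g))) / d"
    proof -
      have "(\<Sum>x\<in>carrier G. f (x \<otimes> n) * h (n \<otimes> (inv (x \<otimes> n) \<otimes> g))) = (\<Sum>x\<in>carrier G. f x * h (n \<otimes> (inv x \<otimes> g)))"
        if "n \<in> N" for n
        by (rule sum_translate_right[where f = "\<lambda>x. f x * h (n \<otimes> (inv x \<otimes> g))", OF NG[OF that]])
      then show ?thesis by simp
    qed
    also have "\<dots> = (\<Sum>x\<in>carrier G. f x * (\<Sum>n\<in>N. h (n \<otimes> (inv x \<otimes> g)))) / d"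
      by (subst sum.swap) (simp add: sum_distrib_left)
    also have "\<dots> = (\<Sum>x\<in>carrier G. f x * (\<Sum>n\<in>N. h (inv x \<otimes> g \<otimes> n))) / d"
    proof -
      have "(\<Sum>n\<in>N. h (n \<otimes> (inv x \<otimes> g))) = (\<Sum>n\<in>N. h (inv x \<otimes> g \<otimes> n))" if "x \<in> carrier G" for x
        unfolding N_def by (rule sum_derived_coset_commute) (use that g in simp)
      then show ?thesis by simp
    qed
    also have "\<dots> = convolve f (av h) g"
      by (simp add: convolve_def av_def sum_divide_distrib[symmetric])
    finally show ?thesis .
  qed
  have av_class: "av f (inv x \<otimes> g \<otimes> x) = av f g" if "x \<in> carrier G" "g \<in> carrier G" for f x g
  proof -
    \<comment> \<open>Conjugation changes \<open>g\<close> only by a commutator on the right, hence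
      not its coset.\<close>
    have "inv x \<otimes> g \<otimes> x = g \<otimes> (inv g \<otimes> inv x \<otimes> g \<otimes> x)" using that by (simp add: m_assoc[symmetric])
    moreover have "inv g \<otimes> inv x \<otimes> g \<otimes> x \<in> N"
      using commutator_in_derived[of "inv g" "inv x"] that by (simp add: N_def)
    ultimately show ?thesis using av_trans that by simp
  qed
  have 1: "convolve a (av a) g = k * av a g + c" if g: "g \<in> carrier G" for g
    using g NG d by (simp add: conv_av) (simp add: av_def a sum.distrib sum_distrib_left add_divide_distrib d_def)
  have 2: "convolve (av a) a g = k * av a g + c" if "g \<in> carrier G" for g
    using that by (simp add: av_conv 1)
  have 3: "convolve (av a) (av a) g = k * av a g + c" if g: "g \<in> carrier G" for g
  proof -
    have "convolve (av a) (av a) g = convolve a (av (av a)) g" by (rule av_conv[OF g])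
    also have "\<dots> = convolve a (av a) g" unfolding convolve_def using g by (intro sum.cong refl) (simp add: av_av)
    finally show ?thesis using 1 g by simp
  qed
  \<comment> \<open>In the square of \<open>E\<close> the four products carry the same constant
    \<open>c\<close> with signs \<open>+, -, -, +\<close>, so it cancels and \<open>E\<close> is
    idempotent.\<close>
  define E where "E g = (a g - av a g) / k" for g
  have "convolve E E g = E g" if g: "g \<in> carrier G" for g
  proof -
    have "convolve E E g = (convolve a a g - convolve a (av a) g - convolve (av a) a g + convolve (av a) (av a) g) / (k * k)"
      unfolding convolve_def E_def
      by (simp add: sum_subtractf[symmetric] sum.distrib[symmetric] sum_divide_distrib algebra_simps diff_divide_distrib add_divide_distrib)
    also have "\<dots> = E g" using k g by (simp add: a 1 2 3 E_def field_simps)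
    finally show ?thesis .
  qed
  from is_character_idempotent[OF fin this]
  show ?thesis
  proof (rule is_character_cong)
    fix g assume g: "g \<in> carrier G"
    have "(\<Sum>x\<in>carrier G. E (inv x \<otimes> g \<otimes> x)) = ((\<Sum>x\<in>carrier G. a (inv x \<otimes> g \<otimes> x)) - (\<Sum>x\<in>carrier G. av a g)) / k"
      unfolding E_def sum_divide_distrib[symmetric] sum_subtractf using g by (simp add: av_class)
    \<comment> \<open>The group order divided by the order of the derived subgroup is the index,
      which produces the factor \<open>|G/G'|\<close> of the formulas.\<close>
    moreover have "(\<Sum>x\<in>carrier G. av a g) = of_nat (card (rcosets N)) * (\<Sum>h\<in>g <# N. a h)"
    proof -
      have "(\<Sum>x\<in>carrier G. av a g) = of_nat (card (rcosets N) * card N) * av a g"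
        unfolding lagrange[OF N] by (simp add: order_def)
      also have "\<dots> = of_nat (card (rcosets N)) * (\<Sum>n\<in>N. a (g \<otimes> n))" using d by (simp add: av_def d_def)
      also have "(\<Sum>n\<in>N. a (g \<otimes> n)) = (\<Sum>h\<in>(\<lambda>n. g \<otimes> n) ` N. a h)"
        using g NG by (subst sum.reindex) (auto simp: inj_on_def)
      also have "(\<lambda>n. g \<otimes> n) ` N = g <# N" by (auto simp: l_coset_def)
      finally show ?thesis .
    qed
    ultimately show "(\<Sum>x\<in>carrier G. E (inv x \<otimes> g \<otimes> x)) = ((\<Sum>x\<in>carrier G. a (inv x \<otimes> g \<otimes> x)) - of_nat (card (rcosets N)) * (\<Sum>h\<in>g <# N. a h)) / k"
      by simp
  qed
qed


section \<open>Bilinearity and indicators of subgroups\<close>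

lemma convolve_cong:
  assumes "g \<in> carrier G" "\<And>h. h \<in> carrier G \<Longrightarrow> a h = a' h" "\<And>h. h \<in> carrier G \<Longrightarrow> b h = b' h"
  shows "convolve a b g = convolve a' b' g"
  unfolding convolve_def using assms by (intro sum.cong) auto

lemma convolve_sum_left: "convolve (\<lambda>g. \<Sum>M\<in>S. a M g) b g = (\<Sum>M\<in>S. convolve (a M) b g)"
  unfolding convolve_def sum_distrib_right by (rule sum.swap)

lemma convolve_sum_right: "convolve a (\<lambda>g. \<Sum>M\<in>S. b M g) g = (\<Sum>M\<in>S. convolve a (b M) g)"
  unfolding convolve_def sum_distrib_left by (rule sum.swap)

lemma convolve_linear_combination:
  "convolve (\<lambda>g. \<alpha> * a g + \<beta> * b g) (\<lambda>g. \<alpha> * a g + \<beta> * b g) g =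
   \<alpha> * \<alpha> * convolve a a g + \<alpha> * \<beta> * (convolve a b g + convolve b a g) + \<beta> * \<beta> * convolve b b g"
  unfolding convolve_def by (simp add: sum_distrib_left sum.distrib[symmetric] algebra_simps)

lemma subgroup_inv_mem_iff:
  assumes "subgroup A G" "h \<in> carrier G"
  shows "inv h \<in> A \<longleftrightarrow> h \<in> A"
  using assms subgroup.m_inv_closed[OF assms(1), of h] subgroup.m_inv_closed[OF assms(1), of "inv h"] by auto

text \<open>For \<open>h\<close> in \<open>A\<close>, translation by \<open>h\<close> preserves
  \<open>B\<close>, so each element of \<open>A\<close> contributes the indicator of
  \<open>B\<close> once.\<close>

lemma convolve_subgroups:
  assumes fin: "finite (carrier G)" and A: "subgroup A G" and B: "subgroup B G" and AB: "A \<subseteq> B" and g: "g \<in> carrier G"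
  shows "convolve (\<lambda>h. of_bool (h \<in> A)) (\<lambda>h. of_bool (h \<in> B)) g = of_nat (card A) * of_bool (g \<in> B)"
proof -
  have "of_bool (h \<in> A) * of_bool (inv h \<otimes> g \<in> B) = (of_bool (h \<in> A) * of_bool (g \<in> B) :: complex)" if h: "h \<in> carrier G" for h
  proof (cases "h \<in> A")
    case True
    then have hB: "h \<in> B" using AB by blast
    have "g = h \<otimes> (inv h \<otimes> g)" using g h by (simp add: m_assoc[symmetric])
    then have "inv h \<otimes> g \<in> B \<longleftrightarrow> g \<in> B"
      using subgroup.m_closed[OF B] subgroup.m_inv_closed[OF B] hB by metis
    then show ?thesis by simp
  qed simp
  then have "convolve (\<lambda>h. of_bool (h \<in> A)) (\<lambda>h. of_bool (h \<in> B)) g = (\<Sum>h\<in>carrier G. of_bool (h \<in> A)) * of_bool (g \<in> B)"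
    unfolding convolve_def sum_distrib_right by (intro sum.cong refl)
  also have "(\<Sum>h\<in>carrier G. of_bool (h \<in> A)) = (of_nat (card A) :: complex)"
    using fin subgroup.subset[OF A] by (simp add: sum.If_cases of_bool_def Int_absorb1)
  finally show ?thesis .
qed

text \<open>For indicators, the conjugation sum in \<open>is_character_quasi_idempotent\<close> is a
  centralizer order times an intersection with the conjugacy class, and the coset sum is an
  intersection with the coset. This gives the shape of both formulas in the theorem.\<close>

lemma is_character_indicator_combination:
  fixes \<alpha> \<beta> k c :: complex
  assumes fin: "finite (carrier G)" and k: "k \<noteq> 0"
    and a: "\<And>g. g \<in> carrier G \<Longrightarrow>
      convolve (\<lambda>g. \<alpha> * (\<Sum>M\<in>S. of_bool (g \<in> A M)) + \<beta> * (\<Sum>M\<in>S. of_bool (g \<in> B M)))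
               (\<lambda>g. \<alpha> * (\<Sum>M\<in>S. of_bool (g \<in> A M)) + \<beta> * (\<Sum>M\<in>S. of_bool (g \<in> B M))) g =
      k * (\<alpha> * (\<Sum>M\<in>S. of_bool (g \<in> A M)) + \<beta> * (\<Sum>M\<in>S. of_bool (g \<in> B M))) + c"
  shows "is_character G (\<lambda>g. 1 / k * (\<Sum>M\<in>S.
       of_nat (card (centralizer_el G g)) *
         (\<alpha> * of_nat (card (A M \<inter> conj_class G g)) + \<beta> * of_nat (card (B M \<inter> conj_class G g)))
       - of_nat (card (rcosets (derived G (carrier G)))) *
         (\<alpha> * of_nat (card (A M \<inter> (g <# derived G (carrier G)))) + \<beta> * of_nat (card (B M \<inter> (g <# derived G (carrier G)))))))"
proof (rule is_character_cong[OF is_character_quasi_idempotent[OF fin k a]])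
  fix g assume g: "g \<in> carrier G"
  let ?N = "derived G (carrier G)"
  have 1: "(\<Sum>x\<in>carrier G. of_bool (inv x \<otimes> g \<otimes> x \<in> D)) =
      (of_nat (card (centralizer_el G g)) * of_nat (card (D \<inter> conj_class G g)) :: complex)" for D
  proof -
    have "(\<Sum>x\<in>carrier G. of_bool (inv x \<otimes> g \<otimes> x \<in> D)) = (of_nat (card {x \<in> carrier G. inv x \<otimes> g \<otimes> x \<in> D}) :: complex)"
      using fin by (simp add: sum.If_cases of_bool_def Collect_conj_eq)
    then show ?thesis by (simp only: card_conjugators_into[OF fin g] of_nat_mult)
  qed
  have fN: "finite (g <# ?N)"
    using finite_subset[OF derived_in_carrier[OF order_refl] fin] by (simp add: l_coset_def)
  have 2: "(\<Sum>h\<in>g <# ?N. of_bool (h \<in> D)) = (of_nat (card (D \<inter> (g <# ?N))) :: complex)" for D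
    using fN by (simp add: sum.If_cases of_bool_def Int_commute)
  have lin: "(\<Sum>x\<in>T. \<alpha> * (\<Sum>M\<in>S. of_bool (f x \<in> A M)) + \<beta> * (\<Sum>M\<in>S. of_bool (f x \<in> B M))) =
     (\<Sum>M\<in>S. \<alpha> * (\<Sum>x\<in>T. of_bool (f x \<in> A M)) + \<beta> * (\<Sum>x\<in>T. of_bool (f x \<in> B M)))" for f :: "'a \<Rightarrow> 'a" and T
    by (simp add: sum.distrib sum_distrib_left[symmetric]) (simp only: sum.swap[of _ S T])
  show "((\<Sum>x\<in>carrier G. \<alpha> * (\<Sum>M\<in>S. of_bool (inv x \<otimes> g \<otimes> x \<in> A M)) + \<beta> * (\<Sum>M\<in>S. of_bool (inv x \<otimes> g \<otimes> x \<in> B M)))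
      - of_nat (card (rcosets ?N)) * (\<Sum>h\<in>g <# ?N. \<alpha> * (\<Sum>M\<in>S. of_bool (h \<in> A M)) + \<beta> * (\<Sum>M\<in>S. of_bool (h \<in> B M)))) / k =
    1 / k * (\<Sum>M\<in>S.
       of_nat (card (centralizer_el G g)) *
         (\<alpha> * of_nat (card (A M \<inter> conj_class G g)) + \<beta> * of_nat (card (B M \<inter> conj_class G g)))
       - of_nat (card (rcosets ?N)) *
         (\<alpha> * of_nat (card (A M \<inter> (g <# ?N))) + \<beta> * of_nat (card (B M \<inter> (g <# ?N)))))"
    unfolding lin[of "\<lambda>x. x"] lin[of "\<lambda>x. inv x \<otimes> g \<otimes> x"] 1 2 sum_distrib_left[of "of_nat (card (rcosets ?N))"]
      sum_subtractf[symmetric] sum_divide_distrib sum_distrib_left[of "1 / k"]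
    by (intro sum.cong refl) (simp add: algebra_simps add_divide_distrib diff_divide_distrib)
qed

end

section \<open>Elation generalized quadrangles\<close>

locale elation_GQ =
  fixes P :: "'p set" and L :: "'l set" and I :: "'p \<Rightarrow> 'l \<Rightarrow> bool"
    and s t :: nat and p y :: 'p and G :: "(('p \<Rightarrow> 'p) \<times> ('l \<Rightarrow> 'l)) set"
  assumes EGQ: "fin_EGQ P L I s t p G"
    and y: "y \<in> P" "\<not> collinear P L I p y"
begin

abbreviation "coll \<equiv> collinear P L I"
abbreviation "\<Gamma> \<equiv> aut_group G"
abbreviation "Ly \<equiv> lines_through L I y"
abbreviation "z \<equiv> proj_pt P L I p"
abbreviation "A \<equiv> fam_A G"
abbreviation "B \<equiv> fam_Astar P L I p G" \<comment> \<open>the subgroups \<open>A\<^sub>i\<^sup>*\<close>\<close>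

definition \<Omega> :: "'p set" where "\<Omega> = {x \<in> P. \<not> coll p x}"

sublocale elations: group \<Gamma>
  using EGQ by (simp add: fin_EGQ_def)

lemma carrier_eq [simp]: "carrier \<Gamma> = G" by (simp add: aut_group_def)

section \<open>The quadrangle and the action on it\<close>

lemma GQ: "fin_GQ P L I s t" and pP: "p \<in> P" and aut: "G \<subseteq> automorphisms P L I"
  using EGQ by (auto simp: fin_EGQ_def)

lemma finite_PL: "finite P" "finite L" and s_pos: "s \<ge> 1" and t_pos: "t \<ge> 1"
  and points_on_line: "l \<in> L \<Longrightarrow> card {x\<in>P. I x l} = s + 1"
  and lines_on_point: "x \<in> P \<Longrightarrow> card {l\<in>L. I x l} = t + 1"
  using GQ by (auto simp: fin_GQ_def)

lemma line_unique:
  "x \<in> P \<Longrightarrow> x' \<in> P \<Longrightarrow> l \<in> L \<Longrightarrow> m \<in> L \<Longrightarrow> x \<noteq> x' \<Longrightarrow> I x l \<Longrightarrow> I x' l \<Longrightarrow> I x m \<Longrightarrow> I x' m \<Longrightarrow> l = m"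
  using GQ unfolding fin_GQ_def by blast

lemma projection_ex1: "x \<in> P \<Longrightarrow> l \<in> L \<Longrightarrow> \<not> I x l \<Longrightarrow> \<exists>!u. u \<in> P \<and> I u l \<and> coll x u"
  using GQ unfolding fin_GQ_def by blast

lemma projection_unique:
  "x \<in> P \<Longrightarrow> l \<in> L \<Longrightarrow> \<not> I x l \<Longrightarrow> I u l \<Longrightarrow> I v l \<Longrightarrow> coll x u \<Longrightarrow> coll x v \<Longrightarrow> u = v"
  using projection_ex1[of x l] by (auto simp: collinear_def)

lemma col_sym: "coll u v \<longleftrightarrow> coll v u" by (auto simp: collinear_def)

lemma colI: "u \<in> P \<Longrightarrow> v \<in> P \<Longrightarrow> l \<in> L \<Longrightarrow> I u l \<Longrightarrow> I v l \<Longrightarrow> coll u v" by (auto simp: collinear_def)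

lemma mult_eq: "fst (a \<otimes>\<^bsub>\<Gamma>\<^esub> b) x = fst a (fst b x)" "snd (a \<otimes>\<^bsub>\<Gamma>\<^esub> b) l = snd a (snd b l)"
  by (simp_all add: aut_group_def)

lemma one_eq: "fst \<one>\<^bsub>\<Gamma>\<^esub> x = x" "snd \<one>\<^bsub>\<Gamma>\<^esub> l = l"
  by (simp_all add: aut_group_def)

lemma inv_in: "h \<in> G \<Longrightarrow> inv\<^bsub>\<Gamma>\<^esub> h \<in> G" using elations.inv_closed by simp

lemma inv_eq:
  assumes "h \<in> G"
  shows "fst (inv\<^bsub>\<Gamma>\<^esub> h) (fst h x) = x" "fst h (fst (inv\<^bsub>\<Gamma>\<^esub> h) x) = x"
    "snd (inv\<^bsub>\<Gamma>\<^esub> h) (snd h l) = l" "snd h (snd (inv\<^bsub>\<Gamma>\<^esub> h) l) = l"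
  using assms elations.l_inv[of h] elations.r_inv[of h] by (metis carrier_eq mult_eq one_eq)+

lemma act_P: "h \<in> G \<Longrightarrow> x \<in> P \<Longrightarrow> fst h x \<in> P" and act_L: "h \<in> G \<Longrightarrow> l \<in> L \<Longrightarrow> snd h l \<in> L"
  and act_I: "h \<in> G \<Longrightarrow> x \<in> P \<Longrightarrow> l \<in> L \<Longrightarrow> I (fst h x) (snd h l) \<longleftrightarrow> I x l"
  using aut by (force simp: automorphisms_def bij_betw_def)+

lemma act_col: 
  assumes h: "h \<in> G" and x: "x \<in> P" "x' \<in> P"
  shows "coll (fst h x) (fst h x') \<longleftrightarrow> coll x x'"
proof
  assume "coll (fst h x) (fst h x')"
  then obtain l where l: "l \<in> L" "I (fst h x) l" "I (fst h x') l" by (auto simp: collinear_def)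
  have "I x (snd (inv\<^bsub>\<Gamma>\<^esub> h) l)" "I x' (snd (inv\<^bsub>\<Gamma>\<^esub> h) l)"
    using l x h act_I[OF h x(1), of "snd (inv\<^bsub>\<Gamma>\<^esub> h) l"] act_I[OF h x(2), of "snd (inv\<^bsub>\<Gamma>\<^esub> h) l"]
    by (simp_all add: inv_eq act_L inv_in)
  then show "coll x x'" using colI[OF x act_L[OF inv_in[OF h] l(1)]] by blast
next
  assume "coll x x'"
  then obtain l where l: "l \<in> L" "I x l" "I x' l" by (auto simp: collinear_def)
  then show "coll (fst h x) (fst h x')" using x h by (auto intro!: colI[of _ _ "snd h l"] act_P act_L simp: act_I)
qed

lemma fix_line: "h \<in> G \<Longrightarrow> l \<in> L \<Longrightarrow> I p l \<Longrightarrow> snd h l = l"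
  using EGQ by (auto simp: fin_EGQ_def is_elation_def)

text \<open>Since \<open>t \<ge> 1\<close>, at least two lines pass through \<open>p\<close>. Both
  are fixed, and \<open>p\<close> is their only common point.\<close>

lemma fix_p: assumes h: "h \<in> G" shows "fst h p = p"
proof (rule ccontr)
  assume ne: "fst h p \<noteq> p"
  have "card {l\<in>L. I p l} \<ge> 2" using lines_on_point[OF pP] t_pos by simp
  then obtain l m where lm: "l \<in> L" "m \<in> L" "I p l" "I p m" "l \<noteq> m"
    by (auto simp: card_le_Suc_iff numeral_2_eq_2)
  have "I (fst h p) l" "I (fst h p) m" using act_I[OF h pP] fix_line[OF h] lm by metis+
  then show False using line_unique[OF act_P[OF h pP] pP lm(1,2) ne] lm by blast
qed

lemma act_\<Omega>: "h \<in> G \<Longrightarrow> x \<in> \<Omega> \<Longrightarrow> fst h x \<in> \<Omega>"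
  using act_col[of h p x] fix_p pP by (auto simp: \<Omega>_def act_P)

lemma y_\<Omega>: "y \<in> \<Omega>" using y by (simp add: \<Omega>_def)

text \<open>Regularity identifies group elements with points not collinear with \<open>p\<close>, so
  that convolutions become counts of points.\<close>

lemma orbit_bij: "bij_betw (\<lambda>h. fst h y) G \<Omega>"
proof -
  have "\<exists>!h. h \<in> G \<and> fst h y = x" if "x \<in> \<Omega>" for x
    using EGQ y that by (auto simp: fin_EGQ_def \<Omega>_def)
  then show ?thesis unfolding bij_betw_def inj_on_def using act_\<Omega> y_\<Omega> by (auto simp: image_iff) metis+
qed

lemma finite_G: "finite G"
  using orbit_bij finite_PL bij_betw_finite by (fastforce simp: \<Omega>_def)

lemma sum_orbit: "(\<Sum>h\<in>G. F (fst h y)) = (\<Sum>w\<in>\<Omega>. F w)"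
  by (rule sum.reindex_bij_betw[OF orbit_bij])

section \<open>Lines through the point y and their points collinear with p\<close>

lemma Ly_iff: "M \<in> Ly \<longleftrightarrow> M \<in> L \<and> I y M" by (simp add: lines_through_def)

lemma finite_Ly: "finite Ly" and card_Ly: "card Ly = t + 1"
  using finite_PL lines_on_point[OF y(1)] by (simp_all add: lines_through_def)

lemma p_not_on: "M \<in> Ly \<Longrightarrow> \<not> I p M"
  using y pP by (auto simp: Ly_iff collinear_def)

lemma z_props:
  assumes "M \<in> Ly"
  shows "z M \<in> P" "I (z M) M" "coll p (z M)" "u \<in> P \<Longrightarrow> I u M \<Longrightarrow> coll p u \<Longrightarrow> u = z M"
proof -
  have ex1: "\<exists>!u. u \<in> P \<and> I u M \<and> coll p u"
    using projection_ex1[OF pP _ p_not_on[OF assms]] assms by (simp add: Ly_iff)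
  from theI'[OF this] show *: "z M \<in> P" "I (z M) M" "coll p (z M)" by (auto simp: proj_pt_def)
  show "u \<in> P \<Longrightarrow> I u M \<Longrightarrow> coll p u \<Longrightarrow> u = z M" using ex1 * by blast
qed

lemma z_ne_p: "M \<in> Ly \<Longrightarrow> z M \<noteq> p" using z_props(2) p_not_on by metis

lemma base_line:
  assumes "M \<in> Ly"
  obtains l where "l \<in> L" "I p l" "I (z M) l"
  using z_props(3)[OF assms] by (auto simp: collinear_def)

section \<open>The 4-gonal family in terms of images of y\<close>

text \<open>Let \<open>l\<close> be the line through \<open>p\<close> and \<open>z M\<close>; it is
  fixed by \<open>h\<close>. If \<open>h\<close> keeps \<open>y\<close> on \<open>M\<close>, then
  \<open>z M\<close> and its image both lie on \<open>l\<close> and are collinear with the image of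
  \<open>y\<close>, so they coincide. The image of \<open>M\<close> then shares two points with
  \<open>M\<close>.\<close>

lemma fam_A_iff:
  assumes M: "M \<in> Ly" and h: "h \<in> G"
  shows "h \<in> A M \<longleftrightarrow> I (fst h y) M"
proof
  have M': "M \<in> L" "I y M" using M by (auto simp: Ly_iff)
  assume "h \<in> A M"
  then show "I (fst h y) M" using act_I[OF h y(1) M'(1)] M' by (simp add: fam_A_def)
next
  have M': "M \<in> L" "I y M" using M by (auto simp: Ly_iff)
  assume hy: "I (fst h y) M"
  obtain l where l: "l \<in> L" "I p l" "I (z M) l" using base_line[OF M] .
  note zM = z_props[OF M]
  have hyP: "fst h y \<in> P" "\<not> coll p (fst h y)" using act_\<Omega>[OF h y_\<Omega>] by (auto simp: \<Omega>_def)
  have nl: "\<not> I (fst h y) l" using hyP l pP by (auto simp: collinear_def)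
  have hz: "I (fst h (z M)) l" using act_I[OF h zM(1) l(1)] fix_line[OF h l(1,2)] l by simp
  have "coll (fst h y) (fst h (z M))" using act_col[OF h y(1) zM(1)] colI[OF y(1) zM(1) M' zM(2)] by simp
  moreover have "coll (fst h y) (z M)" using colI[OF hyP(1) zM(1) M'(1) hy zM(2)] .
  ultimately have fz: "fst h (z M) = z M" using projection_unique[OF hyP(1) l(1) nl hz l(3)] by blast
  have "I (z M) (snd h M)" using act_I[OF h zM(1) M'(1)] zM(2) fz by simp
  moreover have "I (fst h y) (snd h M)" using act_I[OF h y(1) M'(1)] M' by simp
  moreover have "fst h y \<noteq> z M" using zM(3) hyP(2) by auto
  ultimately have "snd h M = M" using line_unique[OF hyP(1) zM(1) act_L[OF h M'(1)] M'(1)] hy zM(2) by blast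
  then show "h \<in> A M" using h by (simp add: fam_A_def)
qed

text \<open>The image of \<open>z M\<close> is the unique point collinear with the image of
  \<open>y\<close> on the line through \<open>p\<close> and \<open>z M\<close>. It equals
  \<open>z M\<close> exactly when \<open>z M\<close> is collinear with the image of
  \<open>y\<close>.\<close>

lemma fam_Astar_iff:
  assumes M: "M \<in> Ly" and h: "h \<in> G"
  shows "h \<in> B M \<longleftrightarrow> coll (fst h y) (z M)"
proof -
  have M': "M \<in> L" "I y M" using M by (auto simp: Ly_iff)
  obtain l where l: "l \<in> L" "I p l" "I (z M) l" using base_line[OF M] .
  note zM = z_props[OF M]
  have hyP: "fst h y \<in> P" "\<not> coll p (fst h y)" using act_\<Omega>[OF h y_\<Omega>] by (auto simp: \<Omega>_def)
  have nl: "\<not> I (fst h y) l" using hyP l pP by (auto simp: collinear_def)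
  have hz: "I (fst h (z M)) l" using act_I[OF h zM(1) l(1)] fix_line[OF h l(1,2)] l by simp
  have c: "coll (fst h y) (fst h (z M))" using act_col[OF h y(1) zM(1)] colI[OF y(1) zM(1) M' zM(2)] by simp
  have "fst h (z M) = z M \<longleftrightarrow> coll (fst h y) (z M)"
    using c projection_unique[OF hyP(1) l(1) nl hz l(3) c] by auto
  then show ?thesis using h by (simp add: fam_Astar_def)
qed

lemma subgroup_A: "subgroup (A M) \<Gamma>"
proof (rule elations.subgroupI)
  show "A M \<noteq> {}" using elations.one_closed one_eq(2)[of M] unfolding fam_A_def carrier_eq by blast
  show "a \<in> A M \<Longrightarrow> b \<in> A M \<Longrightarrow> a \<otimes>\<^bsub>\<Gamma>\<^esub> b \<in> A M" for a b
    using elations.m_closed by (simp add: fam_A_def mult_eq)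
  show "a \<in> A M \<Longrightarrow> inv\<^bsub>\<Gamma>\<^esub> a \<in> A M" for a
    using inv_eq(3)[of a M] by (auto simp: fam_A_def inv_in)
qed (auto simp: fam_A_def)

lemma subgroup_Astar: "subgroup (B M) \<Gamma>"
proof (rule elations.subgroupI)
  show "B M \<noteq> {}" using elations.one_closed one_eq(1)[of "z M"] unfolding fam_Astar_def carrier_eq by blast
  show "a \<in> B M \<Longrightarrow> b \<in> B M \<Longrightarrow> a \<otimes>\<^bsub>\<Gamma>\<^esub> b \<in> B M" for a b
    using elations.m_closed by (simp add: fam_Astar_def mult_eq)
  show "a \<in> B M \<Longrightarrow> inv\<^bsub>\<Gamma>\<^esub> a \<in> B M" for a
    using inv_eq(1)[of a "z M"] by (auto simp: fam_Astar_def inv_in)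
qed (auto simp: fam_Astar_def)

lemma A_subset_Astar: assumes "M \<in> Ly" shows "A M \<subseteq> B M"
proof
  fix h assume h: "h \<in> A M"
  then have hG: "h \<in> G" by (simp add: fam_A_def)
  show "h \<in> B M" unfolding fam_Astar_iff[OF assms hG]
    using colI[OF act_P[OF hG y(1)] z_props(1)[OF assms]] h fam_A_iff[OF assms hG] z_props(2)[OF assms] assms
    by (auto simp: Ly_iff)
qed

lemma affine_points:
  assumes "M \<in> Ly"
  shows "{w \<in> \<Omega>. I w M} = {x \<in> P. I x M} - {z M}" "card {w \<in> \<Omega>. I w M} = s"
proof -
  show *: "{w \<in> \<Omega>. I w M} = {x \<in> P. I x M} - {z M}"
    using z_props(3,4)[OF assms] by (fastforce simp: \<Omega>_def)
  show "card {w \<in> \<Omega>. I w M} = s"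
    using points_on_line[of M] assms z_props(1,2)[OF assms] unfolding * by (simp add: Ly_iff)
qed

lemma card_A: assumes M: "M \<in> Ly" shows "card (A M) = s"
proof -
  have "A M = {h \<in> G. I (fst h y) M}" using fam_A_iff[OF M] by (auto simp: fam_A_def)
  moreover have "bij_betw (\<lambda>h. fst h y) {h \<in> G. I (fst h y) M} {w \<in> \<Omega>. I w M}"
    using orbit_bij by (auto simp: bij_betw_def inj_on_def)
  ultimately show ?thesis using affine_points(2)[OF M] by (simp add: bij_betw_same_card)
qed

text \<open>Besides the line to \<open>p\<close>, the point \<open>z M\<close> is on
  \<open>t\<close> lines. Each carries \<open>s\<close> further points, none of them collinear with
  \<open>p\<close>, and these sets are disjoint.\<close>

lemma card_Astar: assumes M: "M \<in> Ly" shows "card (B M) = s * t"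
proof -
  note zM = z_props[OF M]
  obtain l where l: "l \<in> L" "I p l" "I (z M) l" using base_line[OF M] .
  have "B M = {h \<in> G. coll (fst h y) (z M)}" using fam_Astar_iff[OF M] by (auto simp: fam_Astar_def)
  moreover have "bij_betw (\<lambda>h. fst h y) {h \<in> G. coll (fst h y) (z M)} {w \<in> \<Omega>. coll w (z M)}"
    using orbit_bij by (auto simp: bij_betw_def inj_on_def)
  ultimately have "card (B M) = card {w \<in> \<Omega>. coll w (z M)}" by (simp add: bij_betw_same_card)
  also have "{w \<in> \<Omega>. coll w (z M)} = (\<Union>m\<in>{m\<in>L. I (z M) m} - {l}. {w \<in> P. I w m} - {z M})"
  proof (intro equalityI subsetI)
    fix w assume "w \<in> {w \<in> \<Omega>. coll w (z M)}"
    then obtain m where m: "w \<in> P" "\<not> coll p w" "m \<in> L" "I w m" "I (z M) m" by (auto simp: \<Omega>_def collinear_def)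
    moreover have "m \<noteq> l" using m l pP by (auto simp: collinear_def)
    moreover have "w \<noteq> z M" using m(2) zM(3) by auto
    ultimately show "w \<in> (\<Union>m\<in>{m\<in>L. I (z M) m} - {l}. {w \<in> P. I w m} - {z M})" by blast
  next
    fix w assume "w \<in> (\<Union>m\<in>{m\<in>L. I (z M) m} - {l}. {w \<in> P. I w m} - {z M})"
    then obtain m where m: "w \<in> P" "m \<in> L" "I w m" "I (z M) m" "m \<noteq> l" "w \<noteq> z M" by blast
    have "\<not> I p m" using line_unique[OF pP zM(1) l(1) m(2)] z_ne_p[OF M] l m by metis
    then have "\<not> coll p w" using projection_unique[OF pP m(2) _ m(3,4) _ zM(3)] m(6) by blast
    then show "w \<in> {w \<in> \<Omega>. coll w (z M)}" using m(1) colI[OF m(1) zM(1) m(2,3,4)] by (simp add: \<Omega>_def)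
  qed
  also have "card \<dots> = (\<Sum>m\<in>{m\<in>L. I (z M) m} - {l}. card ({w \<in> P. I w m} - {z M}))"
  proof (rule card_UN_disjoint)
    show "\<forall>i\<in>{m \<in> L. I (z M) m} - {l}. \<forall>j\<in>{m \<in> L. I (z M) m} - {l}. i \<noteq> j \<longrightarrow>
       ({w \<in> P. I w i} - {z M}) \<inter> ({w \<in> P. I w j} - {z M}) = {}"
      using line_unique zM(1) by blast
  qed (use finite_PL in auto)
  also have "\<dots> = (\<Sum>m\<in>{m\<in>L. I (z M) m} - {l}. s)"
    using points_on_line zM(1) by (intro sum.cong refl) simp
  also have "\<dots> = t * s" using lines_on_point[OF zM(1)] l by simp
  finally show ?thesis by simp
qed

section \<open>Products in the group algebra as point counts\<close>

text \<open>Otherwise \<open>y\<close> would be collinear with both \<open>z M\<close> and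
  \<open>z N\<close> on a line not through \<open>y\<close>. They would coincide, and
  \<open>M\<close> and \<open>N\<close> would share two points.\<close>

lemma not_both_feet:
  assumes M: "M \<in> Ly" and N: "N \<in> Ly" and MN: "M \<noteq> N" and l: "l \<in> L" "I p l" "I (z N) l"
  shows "\<not> I (z M) l"
proof
  assume zl: "I (z M) l"
  have "\<not> I y l" using y pP l by (auto simp: collinear_def)
  moreover have "coll y (z M)" "coll y (z N)"
    using colI[OF y(1) z_props(1)[OF M] _ _ z_props(2)[OF M]] colI[OF y(1) z_props(1)[OF N] _ _ z_props(2)[OF N]] M N
    by (simp_all add: Ly_iff)
  ultimately have "z M = z N" using projection_unique[OF y(1) l(1) _ zl l(3)] by blast
  moreover have "y \<noteq> z M" using y(2) z_props(3)[OF M] by auto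
  ultimately show False
    using line_unique[OF y(1) z_props(1)[OF M]] MN M N z_props(2)[OF M] z_props(2)[OF N] by (auto simp: Ly_iff)
qed

text \<open>Membership is invariant under inversion, and \<open>inv g \<otimes> h\<close> can be
  tested on \<open>y\<close> by \<open>fam_Astar_iff\<close>; applying \<open>g\<close> then clears
  the inverse.\<close>

lemma translate_Astar_iff:
  assumes N: "N \<in> Ly" and h: "h \<in> G" and g: "g \<in> G"
  shows "inv\<^bsub>\<Gamma>\<^esub> h \<otimes>\<^bsub>\<Gamma>\<^esub> g \<in> B N \<longleftrightarrow> coll (fst h y) (fst g (z N))"
proof -
  have k: "inv\<^bsub>\<Gamma>\<^esub> g \<otimes>\<^bsub>\<Gamma>\<^esub> h \<in> G" using elations.m_closed elations.inv_closed g h by simp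
  have "inv\<^bsub>\<Gamma>\<^esub> h \<otimes>\<^bsub>\<Gamma>\<^esub> g = inv\<^bsub>\<Gamma>\<^esub> (inv\<^bsub>\<Gamma>\<^esub> g \<otimes>\<^bsub>\<Gamma>\<^esub> h)"
    using elations.inv_mult_group[of "inv\<^bsub>\<Gamma>\<^esub> g" h] elations.inv_inv[of g] inv_in g h by simp
  then have "inv\<^bsub>\<Gamma>\<^esub> h \<otimes>\<^bsub>\<Gamma>\<^esub> g \<in> B N \<longleftrightarrow> inv\<^bsub>\<Gamma>\<^esub> g \<otimes>\<^bsub>\<Gamma>\<^esub> h \<in> B N"
    using elations.subgroup_inv_mem_iff[OF subgroup_Astar, of "inv\<^bsub>\<Gamma>\<^esub> g \<otimes>\<^bsub>\<Gamma>\<^esub> h" N] k by simp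
  also have "\<dots> \<longleftrightarrow> coll (fst (inv\<^bsub>\<Gamma>\<^esub> g) (fst h y)) (z N)" using fam_Astar_iff[OF N k] by (simp add: mult_eq)
  also have "\<dots> \<longleftrightarrow> coll (fst h y) (fst g (z N))"
    using act_col[OF g _ z_props(1)[OF N], of "fst (inv\<^bsub>\<Gamma>\<^esub> g) (fst h y)"] g h y
    by (simp add: inv_eq act_P inv_in)
  finally show ?thesis .
qed

text \<open>The product counts points of \<open>M\<close> that are collinear with \<open>q\<close>,
  the image of \<open>z N\<close> under \<open>g\<close>, and not collinear with \<open>p\<close>.
  There is exactly one: the projection of \<open>q\<close> to \<open>M\<close>.\<close>

lemma convolve_A_Astar:
  assumes M: "M \<in> Ly" and N: "N \<in> Ly" and MN: "M \<noteq> N" and g: "g \<in> G"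
  shows "elations.convolve (\<lambda>h. of_bool (h \<in> A M)) (\<lambda>h. of_bool (h \<in> B N)) g = 1"
proof -
  note zM = z_props[OF M] and zN = z_props[OF N]
  have M': "M \<in> L" "I y M" using M by (auto simp: Ly_iff)
  define q where "q = fst g (z N)"
  have q: "q \<in> P" using act_P[OF g zN(1)] by (simp add: q_def)
  obtain l where l: "l \<in> L" "I p l" "I (z N) l" using base_line[OF N] .
  have ql: "I q l" using act_I[OF g zN(1) l(1)] fix_line[OF g l(1,2)] l by (simp add: q_def)
  have zMl: "\<not> I (z M) l" using not_both_feet[OF M N MN l] .
  have pq: "p \<noteq> q"
  proof
    assume "p = q"
    then have "fst g p = fst g (z N)" using fix_p[OF g] by (simp add: q_def)
    then have "p = z N" using inv_eq(1)[OF g] by metis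
    then show False using z_ne_p[OF N] by simp
  qed
  have qM: "\<not> I q M" using zM(4)[OF q] colI[OF pP q l(1,2) ql] zMl ql by metis
  obtain w where w: "w \<in> P" "I w M" "coll q w" and wu: "\<And>v. v \<in> P \<Longrightarrow> I v M \<Longrightarrow> coll q v \<Longrightarrow> v = w"
    using projection_ex1[OF q M'(1) qM] by blast
  \<comment> \<open>If \<open>w\<close> were \<open>z M\<close>, then \<open>z M\<close>, which is
    off \<open>l\<close>, would be collinear with two distinct points \<open>p\<close> and
    \<open>q\<close> of \<open>l\<close>.\<close>
  have "w \<noteq> z M"
    using projection_unique[OF zM(1) l(1) zMl l(2) ql] pq w(3) zM(3) col_sym by blast
  then have w\<Omega>: "w \<in> \<Omega>" using affine_points(1)[OF M] w by blast
  have "elations.convolve (\<lambda>h. of_bool (h \<in> A M)) (\<lambda>h. of_bool (h \<in> B N)) g =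
    (\<Sum>h\<in>G. of_bool (I (fst h y) M \<and> coll (fst h y) q))"
    unfolding elations.convolve_def
    by (intro sum.cong) (auto simp: fam_A_iff[OF M] translate_Astar_iff[OF N _ g] q_def)
  also have "\<dots> = (\<Sum>v\<in>\<Omega>. of_bool (I v M \<and> coll v q))" by (rule sum_orbit)
  also have "\<dots> = (\<Sum>v\<in>\<Omega>. if v = w then 1 else 0)"
  proof (rule sum.cong[OF refl])
    fix v assume "v \<in> \<Omega>"
    then have "I v M \<and> coll v q \<longleftrightarrow> v = w" using w wu[of v] col_sym[of v q] by (auto simp: \<Omega>_def)
    then show "of_bool (I v M \<and> coll v q) = (if v = w then 1 else 0 :: complex)" by simp
  qed
  also have "\<dots> = 1" using w\<Omega> finite_PL by (simp add: \<Omega>_def)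
  finally show ?thesis .
qed

lemma lines_joining:
  assumes "w \<in> P" "x \<in> P"
  shows "card {m \<in> L. I w m \<and> I x m} = (if w = x then t + 1 else if coll w x then 1 else 0)"
proof (cases "w = x")
  case True
  then show ?thesis using lines_on_point assms by simp
next
  case False
  show ?thesis
  proof (cases "coll w x")
    case True
    then obtain m where m: "m \<in> L" "I w m" "I x m" by (auto simp: collinear_def)
    then have "{m \<in> L. I w m \<and> I x m} = {m}" using line_unique[OF assms _ _ False] by blast
    then show ?thesis using False True by simp
  next
    case f: False
    then have "{m \<in> L. I w m \<and> I x m} = {}" using assms by (auto simp: collinear_def)
    then have "card {m \<in> L. I w m \<and> I x m} = 0" by (simp only: card.empty)
    then show ?thesis using False f by simp
  qed
qed

text \<open>The elation \<open>h\<close> carries the lines through \<open>y\<close> to the lines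
  through its image, so the sum counts lines joining the images of \<open>y\<close> under
  \<open>h\<close> and \<open>g\<close>.\<close>

lemma sum_A_translate:
  assumes h: "h \<in> G" and g: "g \<in> G"
  shows "(\<Sum>N\<in>Ly. of_bool (inv\<^bsub>\<Gamma>\<^esub> h \<otimes>\<^bsub>\<Gamma>\<^esub> g \<in> A N)) = (of_nat (card {m \<in> L. I (fst h y) m \<and> I (fst g y) m}) :: complex)"
proof -
  have k: "inv\<^bsub>\<Gamma>\<^esub> h \<otimes>\<^bsub>\<Gamma>\<^esub> g \<in> G" using elations.m_closed elations.inv_closed g h by simp
  have kA: "inv\<^bsub>\<Gamma>\<^esub> h \<otimes>\<^bsub>\<Gamma>\<^esub> g \<in> A N \<longleftrightarrow> I (fst g y) (snd h N)" if N: "N \<in> Ly" for N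
  proof -
    have "inv\<^bsub>\<Gamma>\<^esub> h \<otimes>\<^bsub>\<Gamma>\<^esub> g \<in> A N \<longleftrightarrow> I (fst (inv\<^bsub>\<Gamma>\<^esub> h) (fst g y)) N" using fam_A_iff[OF N k] by (simp add: mult_eq)
    also have "\<dots> \<longleftrightarrow> I (fst g y) (snd h N)"
      using act_I[OF h, of "fst (inv\<^bsub>\<Gamma>\<^esub> h) (fst g y)" N] g h y N by (simp add: inv_eq act_P inv_in Ly_iff)
    finally show ?thesis .
  qed
  have "(\<Sum>N\<in>Ly. of_bool (inv\<^bsub>\<Gamma>\<^esub> h \<otimes>\<^bsub>\<Gamma>\<^esub> g \<in> A N)) = (\<Sum>N\<in>Ly. of_bool (I (fst g y) (snd h N)) :: complex)"
    using kA by (intro sum.cong) auto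
  also have "\<dots> = of_nat (card {N \<in> Ly. I (fst g y) (snd h N)})"
    using finite_Ly by (simp add: sum.If_cases of_bool_def Collect_conj_eq)
  also have "card {N \<in> Ly. I (fst g y) (snd h N)} = card {m \<in> L. I (fst h y) m \<and> I (fst g y) m}"
  proof (rule bij_betw_same_card[of "snd h"], rule bij_betwI[where g = "snd (inv\<^bsub>\<Gamma>\<^esub> h)"])
    show "snd h \<in> {N \<in> Ly. I (fst g y) (snd h N)} \<rightarrow> {m \<in> L. I (fst h y) m \<and> I (fst g y) m}"
      using h y by (auto simp: Ly_iff act_L act_I)
    show "snd (inv\<^bsub>\<Gamma>\<^esub> h) \<in> {m \<in> L. I (fst h y) m \<and> I (fst g y) m} \<rightarrow> {N \<in> Ly. I (fst g y) (snd h N)}"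
    proof
      fix m assume "m \<in> {m \<in> L. I (fst h y) m \<and> I (fst g y) m}"
      then show "snd (inv\<^bsub>\<Gamma>\<^esub> h) m \<in> {N \<in> Ly. I (fst g y) (snd h N)}"
        using act_I[OF h y(1), of "snd (inv\<^bsub>\<Gamma>\<^esub> h) m"] h y by (simp add: Ly_iff act_L inv_in inv_eq)
    qed
  qed (use h in \<open>auto simp: inv_eq\<close>)
  finally show ?thesis .
qed

text \<open>The product counts lines joining \<open>x\<close>, the image of \<open>y\<close> under
  \<open>g\<close>, to the points of \<open>M\<close> other than \<open>z M\<close>. If
  \<open>x\<close> is on \<open>M\<close>, it contributes \<open>t + 1\<close> itself and the other
  \<open>s - 1\<close> points contribute 1 each. Otherwise only the projection of \<open>x\<close>
  to \<open>M\<close> counts, unless it is \<open>z M\<close>, which means that \<open>g\<close> is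
  in \<open>B M\<close>.\<close>

lemma convolve_A_sum_A:
  assumes M: "M \<in> Ly" and g: "g \<in> G"
  shows "elations.convolve (\<lambda>h. of_bool (h \<in> A M)) (\<lambda>h. \<Sum>N\<in>Ly. of_bool (h \<in> A N)) g =
    (of_nat s + of_nat t) * of_bool (g \<in> A M) - of_bool (g \<in> B M) + 1"
proof -
  note zM = z_props[OF M]
  have M': "M \<in> L" "I y M" using M by (auto simp: Ly_iff)
  define x where "x = fst g y"
  have x: "x \<in> \<Omega>" "x \<in> P" using act_\<Omega>[OF g y_\<Omega>] by (auto simp: x_def \<Omega>_def)
  let ?W = "{w \<in> \<Omega>. I w M}"
  have fin: "finite ?W" "finite \<Omega>" using finite_PL by (auto simp: \<Omega>_def)
  let ?n = "\<lambda>w. if w = x then t + 1 else if coll w x then 1 else 0"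
  have "elations.convolve (\<lambda>h. of_bool (h \<in> A M)) (\<lambda>h. \<Sum>N\<in>Ly. of_bool (h \<in> A N)) g =
    (\<Sum>h\<in>G. (\<lambda>w. if I w M then of_nat (?n w) else 0) (fst h y))"
    unfolding elations.convolve_def
  proof (intro sum.cong)
    fix h assume h: "h \<in> G"
    have "fst h y \<in> P" using act_P[OF h y(1)] .
    then show "of_bool (h \<in> A M) * (\<Sum>N\<in>Ly. of_bool (inv\<^bsub>\<Gamma>\<^esub> h \<otimes>\<^bsub>\<Gamma>\<^esub> g \<in> A N)) =
       (\<lambda>w. if I w M then of_nat (?n w) else (0::complex)) (fst h y)"
      unfolding sum_A_translate[OF h g] fam_A_iff[OF M h] x_def[symmetric] by (simp add: lines_joining x)
  qed simp
  also have "\<dots> = (\<Sum>w\<in>\<Omega>. if I w M then of_nat (?n w) else 0)" by (rule sum_orbit)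
  also have "\<dots> = (\<Sum>w\<in>?W. of_nat (?n w))" using fin by (simp add: sum.inter_filter)
  finally have E: "elations.convolve (\<lambda>h. of_bool (h \<in> A M)) (\<lambda>h. \<Sum>N\<in>Ly. of_bool (h \<in> A N)) g = (\<Sum>w\<in>?W. of_nat (?n w))" .
  show ?thesis
  proof (cases "I x M")
    case True
    have gA: "g \<in> A M" using fam_A_iff[OF M g] True by (simp add: x_def)
    have gB: "g \<in> B M" using gA A_subset_Astar[OF M] by blast
    have "(\<Sum>w\<in>?W. of_nat (?n w)) = (of_nat (t + 1) + (\<Sum>w\<in>?W - {x}. of_nat (?n w)) :: complex)"
      using True x fin by (subst sum.remove[of _ x]) auto
    also have "(\<Sum>w\<in>?W - {x}. of_nat (?n w)) = (\<Sum>w\<in>?W - {x}. 1 :: complex)"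
      using True x M' by (intro sum.cong refl) (auto simp: \<Omega>_def intro: colI)
    also have "\<dots> = of_nat (s - 1)" using True x fin affine_points(2)[OF M] by simp
    finally show ?thesis unfolding E using gA gB s_pos by (simp add: of_nat_diff)
  next
    case False
    have gA: "g \<notin> A M" using fam_A_iff[OF M g] False by (simp add: x_def)
    obtain v where v: "v \<in> P" "I v M" "coll x v" and vu: "\<And>u. u \<in> P \<Longrightarrow> I u M \<Longrightarrow> coll x u \<Longrightarrow> u = v"
      using projection_ex1[OF x(2) M'(1) False] by blast
    have gB: "g \<in> B M \<longleftrightarrow> v = z M" using fam_Astar_iff[OF M g] v(3) vu[OF zM(1,2)] by (auto simp: x_def)
    have "(\<Sum>w\<in>?W. of_nat (?n w)) = (\<Sum>w\<in>?W. if w = v then 1 else 0 :: complex)"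
    proof (rule sum.cong[OF refl])
      fix w assume w: "w \<in> ?W"
      then have "coll w x \<longleftrightarrow> w = v" using v vu[of w] col_sym[of w x] by (auto simp: \<Omega>_def)
      moreover have "w \<noteq> x" using w False by auto
      ultimately show "of_nat (?n w) = (if w = v then 1 else 0 :: complex)" by simp
    qed
    also have "\<dots> = of_bool (v \<noteq> z M)"
      using fin affine_points(1)[OF M] v by (simp add: sum.delta)
    finally show ?thesis unfolding E using gA gB by simp
  qed
qed

abbreviation "ind_A M h \<equiv> (of_bool (h \<in> A M) :: complex)"
abbreviation "ind_B M h \<equiv> (of_bool (h \<in> B M) :: complex)"

lemma indicator_inv: "h \<in> G \<Longrightarrow> ind_A M (inv\<^bsub>\<Gamma>\<^esub> h) = ind_A M h" "h \<in> G \<Longrightarrow> ind_B M (inv\<^bsub>\<Gamma>\<^esub> h) = ind_B M h"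
  using elations.subgroup_inv_mem_iff[OF subgroup_A, of h M] elations.subgroup_inv_mem_iff[OF subgroup_Astar, of h M]
  by simp_all

lemma convolve_A_A_same: "M \<in> Ly \<Longrightarrow> g \<in> G \<Longrightarrow> elations.convolve (ind_A M) (ind_A M) g = of_nat s * ind_A M g"
  using elations.convolve_subgroups[OF _ subgroup_A subgroup_A order_refl, of g M] finite_G card_A by simp

lemma convolve_A_Astar_same: "M \<in> Ly \<Longrightarrow> g \<in> G \<Longrightarrow> elations.convolve (ind_A M) (ind_B M) g = of_nat s * ind_B M g"
  using elations.convolve_subgroups[OF _ subgroup_A subgroup_Astar A_subset_Astar, of M g] finite_G card_A by simp

lemma convolve_Astar_Astar_same: "M \<in> Ly \<Longrightarrow> g \<in> G \<Longrightarrow> elations.convolve (ind_B M) (ind_B M) g = of_nat (s * t) * ind_B M g"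
  using elations.convolve_subgroups[OF _ subgroup_Astar subgroup_Astar order_refl, of g M] finite_G card_Astar by simp

lemma convolve_Astar_A_same:
  assumes M: "M \<in> Ly" and g: "g \<in> G"
  shows "elations.convolve (ind_B M) (ind_A M) g = of_nat s * ind_B M g"
proof -
  have "elations.convolve (ind_B M) (ind_A M) g = elations.convolve (ind_A M) (ind_B M) (inv\<^bsub>\<Gamma>\<^esub> g)"
    using g by (intro elations.convolve_reverse) (simp_all add: indicator_inv)
  then show ?thesis using g by (simp add: convolve_A_Astar_same[OF M] inv_in indicator_inv)
qed

text \<open>Multiplying by \<open>s\<close> lets \<open>B M\<close> be rewritten as its product with
  \<open>A M\<close>. By associativity and \<open>convolve_A_Astar\<close>, what remains is
  \<open>B M\<close> times the sum of all elements, with coefficient \<open>s * t\<close>.\<close>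

lemma convolve_Astar_Astar:
  assumes M: "M \<in> Ly" and N: "N \<in> Ly" and MN: "M \<noteq> N" and g: "g \<in> G"
  shows "elations.convolve (ind_B M) (ind_B N) g = of_nat t"
proof -
  have "of_nat s * elations.convolve (ind_B M) (ind_B N) g = elations.convolve (\<lambda>h. of_nat s * ind_B M h) (ind_B N) g"
    by (simp add: elations.convolve_def sum_distrib_left mult.assoc)
  also have "\<dots> = elations.convolve (elations.convolve (ind_B M) (ind_A M)) (ind_B N) g"
    using g by (intro elations.convolve_cong) (simp_all add: convolve_Astar_A_same[OF M])
  also have "\<dots> = elations.convolve (ind_B M) (elations.convolve (ind_A M) (ind_B N)) g"
    using g by (intro elations.convolve_assoc) simp
  also have "\<dots> = elations.convolve (ind_B M) (\<lambda>_. 1) g"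
    using g by (intro elations.convolve_cong) (simp_all add: convolve_A_Astar[OF M N MN])
  also have "\<dots> = of_nat (card (G \<inter> B M))"
    using finite_G by (simp add: elations.convolve_def sum.If_cases of_bool_def)
  also have "G \<inter> B M = B M" by (auto simp: fam_Astar_def)
  finally show ?thesis using s_pos by (simp add: card_Astar[OF M])
qed

section \<open>Products of the sums over the family\<close>

text \<open>With \<open>sum_Astar\<close>, these are the elements \<open>X\<close> and
  \<open>Y\<close> of the outline. Additive constants in the product formulas below are the
  multiples of \<open>J\<close>.\<close>

definition sum_A :: "('p \<Rightarrow> 'p) \<times> ('l \<Rightarrow> 'l) \<Rightarrow> complex" where "sum_A h = (\<Sum>M\<in>Ly. ind_A M h)"
definition sum_Astar :: "('p \<Rightarrow> 'p) \<times> ('l \<Rightarrow> 'l) \<Rightarrow> complex" where "sum_Astar h = (\<Sum>M\<in>Ly. ind_B M h)"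

lemma sum_diagonal:
  "(\<Sum>M\<in>Ly. \<Sum>N\<in>Ly. if M = N then f M else c) = (\<Sum>M\<in>Ly. f M) + of_nat ((t + 1) * t) * (c :: complex)"
proof -
  have "(\<Sum>N\<in>Ly. if M = N then f M else c) = f M + of_nat t * c" if M: "M \<in> Ly" for M
  proof -
    have "(\<Sum>N\<in>Ly. if M = N then f M else c) = f M + (\<Sum>N\<in>Ly - {M}. if M = N then f M else c)"
      using M finite_Ly by (subst sum.remove[of _ M]) auto
    also have "(\<Sum>N\<in>Ly - {M}. if M = N then f M else c) = (\<Sum>N\<in>Ly - {M}. c)" by (intro sum.cong) auto
    finally show ?thesis using M finite_Ly card_Ly by simp
  qed
  then show ?thesis by (simp add: sum.distrib card_Ly algebra_simps)
qed

lemma convolve_sum_A_sum_A: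
  assumes g: "g \<in> G"
  shows "elations.convolve sum_A sum_A g = (of_nat s + of_nat t) * sum_A g - sum_Astar g + of_nat (t + 1)"
proof -
  have "elations.convolve sum_A sum_A g = (\<Sum>M\<in>Ly. elations.convolve (ind_A M) (\<lambda>h. \<Sum>N\<in>Ly. ind_A N h) g)"
    unfolding sum_A_def[abs_def] by (rule elations.convolve_sum_left)
  also have "\<dots> = (\<Sum>M\<in>Ly. (of_nat s + of_nat t) * ind_A M g - ind_B M g + 1)"
    using g by (intro sum.cong refl) (rule convolve_A_sum_A)
  finally show ?thesis
    by (simp add: sum.distrib sum_subtractf sum_distrib_left sum_A_def sum_Astar_def card_Ly)
qed

lemma convolve_sum_A_sum_Astar:
  assumes g: "g \<in> G"
  shows "elations.convolve sum_A sum_Astar g = of_nat s * sum_Astar g + of_nat ((t + 1) * t)"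
proof -
  have "elations.convolve sum_A sum_Astar g = (\<Sum>M\<in>Ly. \<Sum>N\<in>Ly. elations.convolve (ind_A M) (ind_B N) g)"
    unfolding sum_A_def[abs_def] sum_Astar_def[abs_def] elations.convolve_sum_left elations.convolve_sum_right ..
  also have "\<dots> = (\<Sum>M\<in>Ly. \<Sum>N\<in>Ly. if M = N then of_nat s * ind_B M g else 1)"
    using g by (intro sum.cong refl) (simp add: convolve_A_Astar convolve_A_Astar_same)
  finally show ?thesis unfolding sum_diagonal by (simp add: sum_Astar_def sum_distrib_left)
qed

lemma convolve_sum_Astar_sum_A:
  assumes g: "g \<in> G"
  shows "elations.convolve sum_Astar sum_A g = of_nat s * sum_Astar g + of_nat ((t + 1) * t)"
proof -
  have "elations.convolve sum_Astar sum_A g = elations.convolve sum_A sum_Astar (inv\<^bsub>\<Gamma>\<^esub> g)"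
    using g by (intro elations.convolve_reverse) (simp_all add: sum_A_def sum_Astar_def indicator_inv)
  then show ?thesis
    using g by (simp add: convolve_sum_A_sum_Astar inv_in) (simp add: sum_Astar_def indicator_inv)
qed

lemma convolve_sum_Astar_sum_Astar:
  assumes g: "g \<in> G"
  shows "elations.convolve sum_Astar sum_Astar g = of_nat (s * t) * sum_Astar g + of_nat ((t + 1) * t) * of_nat t"
proof -
  have "elations.convolve sum_Astar sum_Astar g = (\<Sum>M\<in>Ly. \<Sum>N\<in>Ly. elations.convolve (ind_B M) (ind_B N) g)"
    unfolding sum_Astar_def[abs_def] elations.convolve_sum_left elations.convolve_sum_right ..
  also have "\<dots> = (\<Sum>M\<in>Ly. \<Sum>N\<in>Ly. if M = N then of_nat (s * t) * ind_B M g else of_nat t)"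
    using g by (intro sum.cong refl) (simp add: convolve_Astar_Astar convolve_Astar_Astar_same del: of_nat_mult)
  finally show ?thesis unfolding sum_diagonal by (simp add: sum_Astar_def sum_distrib_left)
qed

section \<open>The characters chi_S and chi_T\<close>

text \<open>The unnormalised sum common to both formulas: over all lines through \<open>y\<close>,
  coefficients \<open>s, 1\<close> belong to chi_S and \<open>t, -1\<close> to chi_T. The set
  \<open>S\<close> is a parameter so that a single line can be treated too.\<close>

definition combination :: "'l set \<Rightarrow> complex \<Rightarrow> complex \<Rightarrow> ('p \<Rightarrow> 'p) \<times> ('l \<Rightarrow> 'l) \<Rightarrow> complex" where
  "combination S \<alpha> \<beta> g = (\<Sum>M\<in>S.
       of_nat (card (centralizer_el \<Gamma> g)) *
         (\<alpha> * of_nat (card (A M \<inter> conj_class \<Gamma> g)) + \<beta> * of_nat (card (B M \<inter> conj_class \<Gamma> g)))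
       - of_nat (card (rcosets\<^bsub>\<Gamma>\<^esub> (derived \<Gamma> G))) *
         (\<alpha> * of_nat (card (A M \<inter> (g <#\<^bsub>\<Gamma>\<^esub> derived \<Gamma> G))) + \<beta> * of_nat (card (B M \<inter> (g <#\<^bsub>\<Gamma>\<^esub> derived \<Gamma> G)))))"

lemma is_character_combination:
  assumes k: "k \<noteq> 0"
    and a: "\<And>g. g \<in> G \<Longrightarrow>
      elations.convolve (\<lambda>g. \<alpha> * (\<Sum>M\<in>S. ind_A M g) + \<beta> * (\<Sum>M\<in>S. ind_B M g))
               (\<lambda>g. \<alpha> * (\<Sum>M\<in>S. ind_A M g) + \<beta> * (\<Sum>M\<in>S. ind_B M g)) g =
      k * (\<alpha> * (\<Sum>M\<in>S. ind_A M g) + \<beta> * (\<Sum>M\<in>S. ind_B M g)) + c"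
  shows "is_character \<Gamma> (\<lambda>g. 1 / k * combination S \<alpha> \<beta> g)"
  using elations.is_character_indicator_combination[where S = S and A = A and B = B and \<alpha> = \<alpha> and \<beta> = \<beta> and c = c, OF _ k]
    finite_G a
  unfolding combination_def carrier_eq by simp

text \<open>In the square of \<open>s X + Y\<close> the coefficient of \<open>Y\<close> is
  \<open>- s^2 + 2 s^2 + s t = s (s + t)\<close>, matching that of \<open>X\<close>.\<close>

lemma is_character_S: "is_character \<Gamma> (\<lambda>g. 1 / (of_nat s * (of_nat s + of_nat t)) * combination Ly (of_nat s) 1 g)"
proof (rule is_character_combination)
  show "of_nat s * (of_nat s + of_nat t) \<noteq> (0 :: complex)" using s_pos by (simp flip: of_nat_add)
  fix g assume g: "g \<in> G"
  show "elations.convolve (\<lambda>g. of_nat s * (\<Sum>M\<in>Ly. ind_A M g) + 1 * (\<Sum>M\<in>Ly. ind_B M g))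
      (\<lambda>g. of_nat s * (\<Sum>M\<in>Ly. ind_A M g) + 1 * (\<Sum>M\<in>Ly. ind_B M g)) g =
    of_nat s * (of_nat s + of_nat t) * (of_nat s * (\<Sum>M\<in>Ly. ind_A M g) + 1 * (\<Sum>M\<in>Ly. ind_B M g)) +
    (of_nat s * of_nat s * of_nat (t + 1) + 2 * of_nat s * of_nat ((t + 1) * t) + of_nat ((t + 1) * t) * of_nat t)"
    unfolding sum_A_def[symmetric] sum_Astar_def[symmetric] elations.convolve_linear_combination
      convolve_sum_A_sum_A[OF g] convolve_sum_A_sum_Astar[OF g] convolve_sum_Astar_sum_A[OF g] convolve_sum_Astar_sum_Astar[OF g]
    by (simp add: algebra_simps)
qed

text \<open>In the square of \<open>t X - Y\<close> the coefficient of \<open>Y\<close> is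
  \<open>- t^2 - 2 s t + s t = - t (s + t)\<close>.\<close>

lemma is_character_T_small: "is_character \<Gamma> (\<lambda>g. 1 / (of_nat t * (of_nat s + of_nat t)) * combination Ly (of_nat t) (- 1) g)"
proof (rule is_character_combination)
  show "of_nat t * (of_nat s + of_nat t) \<noteq> (0 :: complex)" using t_pos by (simp flip: of_nat_add)
  fix g assume g: "g \<in> G"
  show "elations.convolve (\<lambda>g. of_nat t * (\<Sum>M\<in>Ly. ind_A M g) + - 1 * (\<Sum>M\<in>Ly. ind_B M g))
      (\<lambda>g. of_nat t * (\<Sum>M\<in>Ly. ind_A M g) + - 1 * (\<Sum>M\<in>Ly. ind_B M g)) g =
    of_nat t * (of_nat s + of_nat t) * (of_nat t * (\<Sum>M\<in>Ly. ind_A M g) + - 1 * (\<Sum>M\<in>Ly. ind_B M g)) +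
    (of_nat t * of_nat t * of_nat (t + 1) - 2 * of_nat t * of_nat ((t + 1) * t) + of_nat ((t + 1) * t) * of_nat t)"
    unfolding sum_A_def[symmetric] sum_Astar_def[symmetric] elations.convolve_linear_combination
      convolve_sum_A_sum_A[OF g] convolve_sum_A_sum_Astar[OF g] convolve_sum_Astar_sum_A[OF g] convolve_sum_Astar_sum_Astar[OF g]
    by (simp add: algebra_simps)
qed

lemma is_character_T_large: "is_character \<Gamma> (\<lambda>g. 1 / (of_nat s * of_nat t) * combination Ly (of_nat t) (- 1) g)"
proof -
  have "is_character \<Gamma> (\<lambda>g. 1 / (of_nat s * of_nat t) * combination {M} (of_nat t) (- 1) g)" if M: "M \<in> Ly" for M
  proof (rule is_character_combination)
    show "of_nat s * of_nat t \<noteq> (0 :: complex)" using s_pos t_pos by simp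
    fix g assume g: "g \<in> G"
    have "elations.convolve (\<lambda>g. of_nat t * ind_A M g + - 1 * ind_B M g) (\<lambda>g. of_nat t * ind_A M g + - 1 * ind_B M g) g =
      of_nat s * of_nat t * (of_nat t * ind_A M g + - 1 * ind_B M g) + 0"
      unfolding elations.convolve_linear_combination convolve_A_A_same[OF M g] convolve_A_Astar_same[OF M g]
        convolve_Astar_A_same[OF M g] convolve_Astar_Astar_same[OF M g] by (simp add: algebra_simps)
    then show "elations.convolve (\<lambda>g. of_nat t * (\<Sum>M\<in>{M}. ind_A M g) + - 1 * (\<Sum>M\<in>{M}. ind_B M g))
        (\<lambda>g. of_nat t * (\<Sum>M\<in>{M}. ind_A M g) + - 1 * (\<Sum>M\<in>{M}. ind_B M g)) g =
      of_nat s * of_nat t * (of_nat t * (\<Sum>M\<in>{M}. ind_A M g) + - 1 * (\<Sum>M\<in>{M}. ind_B M g)) + 0"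
      by (simp only: sum.insert[OF finite.emptyI] empty_iff not_False_eq_True sum.empty add_0_right)
  qed
  then have "is_character \<Gamma> (\<lambda>g. \<Sum>M\<in>Ly. 1 / (of_nat s * of_nat t) * combination {M} (of_nat t) (- 1) g)"
    by (intro elations.is_character_sum finite_Ly)
  then show ?thesis by (simp add: combination_def sum_distrib_left)
qed

lemma is_character_T:
  "is_character \<Gamma> (\<lambda>g. of_nat (gcd s t) / (of_nat s * of_nat t * (of_nat s + of_nat t)) * combination Ly (of_nat t) (- 1) g)"
    (is "is_character \<Gamma> ?\<chi>")
proof -
  define d where "d = gcd s t"
  have "gcd s t \<noteq> 0" using s_pos by simp
  from gcd_coprime_exists[OF this] obtain m n where mn: "s = m * d" "t = n * d" "coprime m n"
    unfolding d_def by blast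
  have pos: "m > 0" "n > 0" "d > 0" using s_pos t_pos mn by (auto intro!: gr0I)
  have st: "of_nat s + of_nat t = (of_nat (m + n) * of_nat d :: complex)" by (simp add: mn algebra_simps)
  let ?s = "of_nat s :: complex" and ?t = "of_nat t :: complex"
  have nz: "?s \<noteq> 0" "?s + ?t \<noteq> 0" using s_pos by (simp_all flip: of_nat_add)
  \<comment> \<open>With \<open>s = m d\<close> and \<open>s + t = (m + n) d\<close>, the factors
    \<open>m\<close> and \<open>m + n\<close> cancel \<open>s\<close> and \<open>s + t\<close> from
    the denominator. This leaves the normalisations of \<open>is_character_T_small\<close> and
    \<open>is_character_T_large\<close>.\<close>
  have "of_nat m * (of_nat d / (?s * ?t * (?s + ?t))) = (of_nat m * of_nat d) / (?s * ?t * (?s + ?t))" by simp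
  also have "of_nat m * of_nat d = ?s" by (simp add: mn)
  also have "?s / (?s * ?t * (?s + ?t)) = 1 / (?t * (?s + ?t))" using nz by simp
  finally have small: "of_nat m * (of_nat d / (?s * ?t * (?s + ?t))) = 1 / (?t * (?s + ?t))" .
  have "of_nat (m + n) * (of_nat d / (?s * ?t * (?s + ?t))) = (?s + ?t) / (?s * ?t * (?s + ?t))"
    unfolding st by simp
  also have "\<dots> = 1 / (?s * ?t)" using nz by simp
  finally have large: "of_nat (m + n) * (of_nat d / (?s * ?t * (?s + ?t))) = 1 / (?s * ?t)" .
  show ?thesis
  proof (rule elations.is_character_coprime_multiples)
    show "coprime m (m + n)" using mn(3) by (simp add: coprime_iff_gcd_eq_1)
    show "is_character \<Gamma> (\<lambda>g. of_nat m * ?\<chi> g)"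
      unfolding d_def[symmetric] mult.assoc[of "of_nat m", symmetric] small by (rule is_character_T_small)
    show "is_character \<Gamma> (\<lambda>g. of_nat (m + n) * ?\<chi> g)"
      unfolding d_def[symmetric] mult.assoc[of "of_nat (m + n)", symmetric] large by (rule is_character_T_large)
  qed (use finite_G pos in auto)
qed

end

theorem theorem2p2:
  fixes P :: "'p set" and L :: "'l set" and I :: "'p \<Rightarrow> 'l \<Rightarrow> bool"
    and s t :: nat and p y :: 'p and G :: "(('p \<Rightarrow> 'p) \<times> ('l \<Rightarrow> 'l)) set"
  assumes EGQ: "fin_EGQ P L I s t p G"
    and y: "y \<in> P" "\<not> collinear P L I p y"
  defines "\<G> \<equiv> aut_group G"
  defines "G' \<equiv> derived \<G> G"
  defines "A \<equiv> fam_A G" and "Astar \<equiv> fam_Astar P L I p G"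
  defines "\<chi>S \<equiv> (\<lambda>g. (1 / (of_nat s * (of_nat s + of_nat t))) *
      (\<Sum>M\<in>lines_through L I y.
         of_nat (card (centralizer_el \<G> g)) *
           (of_nat s * of_nat (card (A M \<inter> conj_class \<G> g)) + of_nat (card (Astar M \<inter> conj_class \<G> g)))
         - of_nat (card (rcosets\<^bsub>\<G>\<^esub> G')) *
           (of_nat s * of_nat (card (A M \<inter> (g <#\<^bsub>\<G>\<^esub> G'))) + of_nat (card (Astar M \<inter> (g <#\<^bsub>\<G>\<^esub> G'))))) :: complex)"
  defines "\<chi>T \<equiv> (\<lambda>g. (of_nat (gcd s t) / (of_nat s * of_nat t * (of_nat s + of_nat t))) *
      (\<Sum>M\<in>lines_through L I y.
         of_nat (card (centralizer_el \<G> g)) *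
           (of_nat t * of_nat (card (A M \<inter> conj_class \<G> g)) - of_nat (card (Astar M \<inter> conj_class \<G> g)))
         - of_nat (card (rcosets\<^bsub>\<G>\<^esub> G')) *
           (of_nat t * of_nat (card (A M \<inter> (g <#\<^bsub>\<G>\<^esub> G'))) - of_nat (card (Astar M \<inter> (g <#\<^bsub>\<G>\<^esub> G'))))) :: complex)"
  shows "is_character \<G> \<chi>S \<and> is_character \<G> \<chi>T"
proof -
  interpret elation_GQ P L I s t p y G using EGQ y by unfold_locales
  show ?thesis
    using is_character_S is_character_T
    unfolding combination_def \<chi>S_def \<chi>T_def \<G>_def G'_def A_def Astar_def by simp
qed

end
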